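(* Let $n\ge1$, let $m$ be a positive integer, and let $\eta=(\eta_1,\dots,\eta_n)$ be a vector of integers in $\mathcal A^{\tilde A_{n-1}}_m=\{(x_1,\dots,x_n)\in\mathbb R^n: x_1>x_2>\dots>x_n>x_1-m\}$. Then, as $k\to\infty$, the number of walks which start at $\eta$, consist of exactly $k$ standard steps in the positive direction (with arbitrary end point), and stay in $\mathcal A^{\tilde A_{n-1}}_m$, is asymptotically $$\frac{2^{\binom n2}}{m^{n/2}}\left(\frac{\sin\frac{n\pi}{m}}{\sin\frac{\pi}{m}}\right)^k\prod_{1\le h<t\le n}\sin\frac{\pi(\eta_h-\eta_t)}{m}\left(\prod_{h=1}^{n/2}\cot\frac{(2h-1)\pi}{2m}+(-1)^{|\eta|+k+\frac n2}\prod_{h=1}^{n/2}\tan\frac{(2h-1)\pi}{2m}\right)$$ if both $n$ and $m$ are even; it is asymptotically $$\frac{2^{\binom n2}}{m^{n/2}}\left(\frac{\sin\frac{n\pi}{m}}{\sin\frac{\pi}{m}}\right)^k\prod_{1\le h<t\le n}\sin\frac{\pi(\eta_h-\eta_t)}{m}\prod_{h=1}^{n/2}\cot\frac{(2h-1)\pi}{2m}$$ if $n$ is even and $m$ is odd; and it is asymptotically $$\frac{2^{\binom n2}}{m^{(n-1)/2}}\left(\frac{\sin\frac{n\pi}{m}}{\sin\frac{\pi}{m}}\right)^k\prod_{1\le h<t\le n}\sin\frac{\pi(\eta_h-\eta_t)}{m}\prod_{h=1}^{(n-1)/2}\cot\frac{h\pi}{m}$$ if $n$ is odd (regardless of $m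$).
   Context: For $\eta\in\mathbb R^n$, $|\eta|=\eta_1+\dots+\eta_n$. $e_j$ is the $j$-th standard unit vector. A walk with $k$ steps with step set $S$ is a sequence $p_0,p_1,\dots,p_k$ with $p_i-p_{i-1}\in S$; "standard steps in the positive direction" means $S=\{e_1,\dots,e_n\}$. The walk stays in a region $R$ if all $p_i\in R$. "Asymptotically $E$" means the ratio of the count to $E$ tends to $1$. *)

theory Defs
  imports
    Complex_Main
    "HOL-Library.Landau_Symbols"
    "Jordan_Normal_Form.Matrix"
begin

text \<open>
  Points of \<open>\<real>\<^sup>n\<close> are vectors in \<open>carrier_vec n\<close>. Coordinates are indexed from 0, so that
  \<open>x\<^sub>1, \<dots>, x\<^sub>n\<close> are \<open>x $ 0, \<dots>, x $ (n - 1)\<close>.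
\<close>

definition alcove :: "nat \<Rightarrow> nat \<Rightarrow> real vec set" where
  "alcove n m =
     {x \<in> carrier_vec n. (\<forall>i. Suc i < n \<longrightarrow> x $ i > x $ Suc i) \<and> x $ (n - 1) > x $ 0 - real m}"

definition standard_steps :: "nat \<Rightarrow> real vec set" where
  "standard_steps n = {unit_vec n j | j. j < n}"

text \<open>A walk with \<open>k\<close> steps is the list of its \<open>k + 1\<close> points.\<close>

definition walks_from :: "real vec set \<Rightarrow> real vec set \<Rightarrow> real vec \<Rightarrow> nat \<Rightarrow> real vec list set" where
  "walks_from S R a k =
     {p. length p = k + 1 \<and> p ! 0 = a \<and> (\<forall>i<k. p ! Suc i - p ! i \<in> S) \<and> set p \<subseteq> R}"

text \<open>
  The quotient \<open>sin (n\<pi>/m) / sin (\<pi>/m)\<close>. For \<open>m = 1\<close> it is formally \<open>0/0\<close>; a region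
  with \<open>m = 1\<close> contains integer points only if \<open>n = 1\<close>, where numerator and denominator are the
  same expression, so the quotient is read as 1 there. (Division by zero in HOL would yield 0.)
\<close>

definition sine_quotient :: "nat \<Rightarrow> nat \<Rightarrow> real" where
  "sine_quotient n m =
     (if m = 1 then 1 else sin (real n * pi / real m) / sin (pi / real m))"

text \<open>
  For \<open>m = n \<ge> 2\<close> there are no walks with \<open>k \<ge> 1\<close> steps and the sine quotient is 0, so the ratio of
  the count to the asymptotic expression is \<open>0/0\<close>; \<open>asymp_equiv\<close> counts such a ratio as 1. In all other
  cases with an integer starting point the expression is nonzero for every \<open>k\<close>, and \<open>asymp_equiv\<close> says
  that the ratio tends to 1.
\<close>

end

theory Submission
  imports
    Defs
    "Jordan_Normal_Form.Determinant"
    "HOL-Library.FuncSet"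
begin

text \<open>
  On the alcove the constant function 1 is a multiple of the Pfaffian of the matrix of signs
  \<open>sgn (x\<^sub>a - x\<^sub>b)\<close>. Extended (anti)periodically with period \<open>m\<close>, and corrected for odd \<open>n\<close> by a
  linear term which the Pfaffian does not see, the sign is a finite sine series with coefficients
  \<open>2/m cot (\<theta>/2)\<close>. Expanding the Pfaffian writes 1 as a combination of Slater determinants
  \<open>det (exp (i q\<^sub>a x\<^sub>b))\<close> whose frequencies come in pairs \<open>\<plusminus>\<theta>\<close>. These vanish on the walls of the
  alcove and are eigenfunctions of the step operator, so the number of \<open>k\<close>-step walks is a
  combination of \<open>k\<close>-th powers of the eigenvalues \<open>\<Sum> 2 cos \<theta>\<close> (plus 1 for odd \<open>n\<close>). The
  eigenvalue of largest modulus comes from the smallest angles, and for even \<open>n\<close> and \<open>m\<close> its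
  negative comes from the largest angles; there the Slater determinants are Vandermonde
  determinants, i.e. products of sines.
\<close>

section \<open>Trigonometric sums\<close>

text \<open>The end point is free, so the count is studied as a function of the starting point: it
  is 1 for \<open>k = 0\<close>, it is 0 outside the alcove, and one more step sums it over the
  \<open>n\<close> neighbours. What is needed is an eigenfunction expansion of the constant 1 on the
  alcove. The parity of \<open>n\<close> decides its shape. On the wall where the first and last
  coordinates differ by \<open>m\<close>, two columns are proportional only if exp(i m q) is the
  same for all \<open>n\<close> frequencies q. Pairs of opposite frequencies allow the values 1 and
  -1; for odd \<open>n\<close> the unpaired frequency 0 forces 1. The value 1 means a sawtooth
  instead of a sign, and the linear difference between them is killed only if there is an unpaired
  index. Hence odd multiples of pi/m for even \<open>n\<close> and even multiples for odd
  \<open>n\<close>. With h = \<open>n div 2\<close>, the alternating sum of signs is 2^h h! up to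
  sign: h! cancels against the orderings of h angles, 2^h against the coefficients 2/m, which leaves
  m^(-h). The factor 2^(n choose 2) comes from the products of sines.\<close>

lemma sin_diff_expand:
  fixes u v :: real
  shows "sin (u + v) - sin (u - v) = 2 * cos u * sin v"
  by (simp add: sin_add sin_diff)

text \<open>Telescoping: \<open>sin b\<close> times a summand is a difference of sines of two
  multiples of \<open>b\<close>. The parameter \<open>d\<close> treats odd and even multiples at
  once; the identity serves both the sine series and the eigenvalues.\<close>

lemma dirichlet_kernel:
  fixes b :: real and d :: nat
  assumes "d < 2"
  shows "sin b * (real d + (\<Sum>j=1..M. 2 * cos ((2 * real j - 1 + real d) * b))) = sin (real (2 * M + d) * b)"
proof (induction M)
  case 0
  show ?case using assms by (cases d) auto
next
  case (Suc M)
  have "sin (real (2 * Suc M + d) * b) - sin (real (2 * M + d) * b)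
      = 2 * cos ((2 * real (Suc M) - 1 + real d) * b) * sin b"
    using sin_diff_expand[of "(2 * real (Suc M) - 1 + real d) * b" b] by (simp add: algebra_simps)
  moreover have "(\<Sum>j=1..Suc M. 2 * cos ((2 * real j - 1 + real d) * b))
      = (\<Sum>j=1..M. 2 * cos ((2 * real j - 1 + real d) * b)) + 2 * cos ((2 * real (Suc M) - 1 + real d) * b)"
    by simp
  ultimately show ?case
    using Suc.IH by (simp only: distrib_left) (simp add: mult_ac)
qed

lemma sin_npi_diff: "sin (real e * pi - b) = - ((-1) ^ e * sin b)"
  by (simp add: sin_diff mult.commute)

text \<open>The positive solutions of exp(i m theta) = -1 for even \<open>n\<close>, and of exp(i m
  theta) = 1 for odd \<open>n\<close>.\<close>

definition theta :: "nat \<Rightarrow> nat \<Rightarrow> nat \<Rightarrow> real" where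
  "theta n m j = (2 * real j - 1 + real (n mod 2)) * (pi / real m)"

text \<open>Counts the angles strictly below pi. If \<open>n\<close> and \<open>m\<close> have
  different parity, the progression also hits pi itself; that angle is left out because its
  coefficient cot(pi/2) is 0.\<close>

definition num_angles :: "nat \<Rightarrow> nat \<Rightarrow> nat" where
  "num_angles n m = (m - n mod 2) div 2"

lemma theta_bounds:
  assumes "j \<in> {1..num_angles n m}"
  shows "0 < theta n m j" "theta n m j \<le> pi"
proof -
  have j: "1 \<le> j" "2 * j + n mod 2 \<le> m" using assms by (auto simp: num_angles_def)
  then have "m > 0" by auto
  moreover have "0 < 2 * real j - 1 + real (n mod 2)" using j by simp
  ultimately show "0 < theta n m j" unfolding theta_def by simp
  have "2 * real j - 1 + real (n mod 2) \<le> real m" using j(2) by linarith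
  then have "(2 * real j - 1 + real (n mod 2)) * (pi / real m) \<le> real m * (pi / real m)"
    by (intro mult_right_mono) auto
  then show "theta n m j \<le> pi" unfolding theta_def using \<open>m > 0\<close> by simp
qed

lemma theta_less_pi:
  assumes "j \<in> {1..num_angles n m}"
  shows "theta n m j < pi"
proof -
  have j: "1 \<le> j" "2 * j + n mod 2 \<le> m" using assms by (auto simp: num_angles_def)
  then have "m > 0" by auto
  have "2 * real j - 1 + real (n mod 2) < real m" using j(2) by linarith
  then have "(2 * real j - 1 + real (n mod 2)) * (pi / real m) < real m * (pi / real m)"
    using \<open>m > 0\<close> by (intro mult_strict_right_mono) auto
  then show ?thesis unfolding theta_def using \<open>m > 0\<close> by simp
qed

text \<open>The Dirichlet kernel at b = e pi / m. Its sine has argument m b = e pi, hence vanishes,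
  if \<open>n\<close> and \<open>m\<close> have the same parity; otherwise the argument is (m - 1)
  b.\<close>

lemma cos_theta_sum:
  assumes "0 < e" "e < m"
  shows "(\<Sum>j=1..num_angles n m. 2 * cos (theta n m j * real e))
       = (if 2 * num_angles n m + n mod 2 = m then 0 else - ((-1) ^ e)) - real (n mod 2)"
proof -
  define b where "b = real e * pi / real m"
  define d where "d = n mod 2"
  have b: "0 < b" "b < pi" using assms unfolding b_def by (auto simp: field_simps)
  then have s: "sin b > 0" by (rule sin_gt_zero)
  have d: "d < 2" "d \<le> m" using assms by (auto simp: d_def)
  have "theta n m j * real e = (2 * real j - 1 + real d) * b" for j
    by (simp add: theta_def b_def d_def)
  then have *: "sin b * (real d + (\<Sum>j=1..num_angles n m. 2 * cos (theta n m j * real e)))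
      = sin (real (2 * num_angles n m + d) * b)"
    using dirichlet_kernel[OF d(1), of b "num_angles n m"] by simp
  have mb: "real m * b = real e * pi" using assms by (simp add: b_def)

  show ?thesis
  proof (cases "2 * num_angles n m + d = m")
    case True
    have "sin (real (2 * num_angles n m + d) * b) = 0" unfolding True mb by simp
    then have "real d + (\<Sum>j=1..num_angles n m. 2 * cos (theta n m j * real e)) = 0" using * s by simp
    then show ?thesis using True unfolding d_def by simp
  next
    case False
    then have h: "real (2 * num_angles n m + d) = real m - 1"
      using d unfolding num_angles_def d_def[symmetric] by linarith
    have "sin b * (real d + (\<Sum>j=1..num_angles n m. 2 * cos (theta n m j * real e))) = sin b * (- ((-1) ^ e))"
      using * unfolding h left_diff_distrib mb by (simp add: sin_npi_diff)
    then have "real d + (\<Sum>j=1..num_angles n m. 2 * cos (theta n m j * real e)) = - ((-1) ^ e)"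
      by (rule mult_left_cancel[THEN iffD1, rotated]) (use s in auto)
    then show ?thesis using False unfolding d_def by simp
  qed
qed

text \<open>With u midway between the arguments, the difference of sines is 2 cos u sin(t/2). The
  cotangent trades sin(t/2) for cos(t/2), and the product is again a sum of two cosines: this is why
  cotangents appear as coefficients.\<close>

lemma cot_half_sin_Suc:
  fixes t :: real
  assumes "sin (t / 2) \<noteq> 0"
  shows "cot (t / 2) * sin (t * real (Suc e)) - cot (t / 2) * sin (t * real e)
       = cos (t * real (Suc e)) + cos (t * real e)"
proof -
  define u where "u = t * real e + t / 2"
  have s: "t * real (Suc e) = u + t / 2" "t * real e = u - t / 2"
    by (auto simp: u_def algebra_simps)
  show ?thesis
    unfolding s right_diff_distrib[symmetric] sin_diff_expand
    using assms by (simp add: cot_def cos_add cos_diff)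
qed

text \<open>A discrete Fourier series, of a square wave for even \<open>n\<close> and of a sawtooth
  for odd \<open>n\<close>. It is verified through its differences in \<open>e\<close>, which are
  cosine sums of known value.\<close>

lemma cot_sum:
  assumes "0 < e" "e < m"
  shows "(\<Sum>j=1..num_angles n m. 2 / real m * cot (theta n m j / 2) * sin (theta n m j * real e))
       = 1 - 2 * real (n mod 2) * real e / real m"
proof -
  define F where "F e = (\<Sum>j=1..num_angles n m. 2 * (cot (theta n m j / 2) * sin (theta n m j * real e)))" for e
  define C where "C e = (\<Sum>j=1..num_angles n m. 2 * cos (theta n m j * real e))" for e
  have nz: "sin (theta n m j / 2) \<noteq> 0" if "j \<in> {1..num_angles n m}" for j
    using theta_bounds[OF that] sin_gt_zero[of "theta n m j / 2"] by auto
  have step: "F (Suc e) = F e + C (Suc e) + C e" for e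
  proof -
    have "F (Suc e) - F e - C (Suc e) - C e = (\<Sum>j=1..num_angles n m. 2 * ((cot (theta n m j / 2) * sin (theta n m j * real (Suc e))
      - cot (theta n m j / 2) * sin (theta n m j * real e)) - cos (theta n m j * real (Suc e)) - cos (theta n m j * real e)))"
      unfolding F_def C_def sum_subtractf[symmetric] by (intro sum.cong refl) (simp add: right_diff_distrib)
    also have "\<dots> = 0"
      using cot_half_sin_Suc nz by (intro sum.neutral ballI) (smt (verit))
    finally show ?thesis by simp
  qed
  have F: "F e = real m - 2 * real (n mod 2) * real e"
    using assms
  proof (induction e rule: nat_induct_non_zero)
    case 1
    have c: "C (Suc 0) = (if 2 * num_angles n m + n mod 2 = m then 0 else 1) - real (n mod 2)"
      using cos_theta_sum[of 1 m n] 1 by (simp add: C_def)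
    have "real (2 * num_angles n m + n mod 2) = (if 2 * num_angles n m + n mod 2 = m then real m else real m - 1)"
      using 1 unfolding num_angles_def by auto
    moreover have "F 0 = 0" "C 0 = 2 * real (num_angles n m)" by (auto simp: F_def C_def)
    ultimately show ?case using step[of 0] c by (simp split: if_splits)
  next
    case (Suc e)
    \<comment> \<open>Alternating terms \<open>(-1) ^ e\<close>, if present, cancel between
      neighbours.\<close>
    have "C e + C (Suc e) = - 2 * real (n mod 2)" unfolding C_def
      using Suc cos_theta_sum[of e m n] cos_theta_sum[of "Suc e" m n] by simp
    then show ?case using Suc step[of e] by (simp add: algebra_simps)
  qed
  have "(\<Sum>j=1..num_angles n m. 2 / real m * cot (theta n m j / 2) * sin (theta n m j * real e)) = F e / real m"
    unfolding F_def sum_divide_distrib by (intro sum.cong) auto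
  then show ?thesis using F assms by (simp add: diff_divide_distrib)
qed

section \<open>Alternating sums over nested pairings\<close>

text \<open>
  For antisymmetric \<open>W\<close> independent of \<open>l\<close> this is, up to sign, a multiple of the Pfaffian. Pairing
  position \<open>l\<close> with \<open>n - 1 - l\<close> puts the frequencies of the dominant eigenfunction in arithmetic
  progression.
\<close>

definition nested :: "nat \<Rightarrow> (nat \<Rightarrow> nat \<Rightarrow> nat \<Rightarrow> complex) \<Rightarrow> complex" where
  "nested n W = (\<Sum>p | p permutes {..<n}. of_int (sign p) * (\<Prod>l<n div 2. W l (p l) (p (n - Suc l))))"

lemma alternating_sum_zero:
  fixes F :: "(nat \<Rightarrow> nat) \<Rightarrow> complex"
  assumes "\<And>p. p \<in> A \<Longrightarrow> g p \<in> A" "\<And>p. p \<in> A \<Longrightarrow> g (g p) = p"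
    and "\<And>p. p \<in> A \<Longrightarrow> sign (g p) = - sign p" "\<And>p. p \<in> A \<Longrightarrow> F (g p) = F p"
  shows "(\<Sum>p\<in>A. of_int (sign p) * F p) = 0"
proof -
  have "(\<Sum>p\<in>A. of_int (sign p) * F p) = (\<Sum>p\<in>A. of_int (sign (g p)) * F (g p))"
    by (rule sum.reindex_bij_witness[of _ g g]) (use assms in auto)
  also have "\<dots> = - (\<Sum>p\<in>A. of_int (sign p) * F p)"
    using assms by (simp add: sum_negf[symmetric])
  finally show ?thesis by (simp add: eq_neg_iff_add_eq_0 flip: mult_2)
qed

lemma sign_compose_transpose:
  fixes p :: "nat \<Rightarrow> nat"
  assumes "p permutes {..<n}" "a \<noteq> b"
  shows "sign (p \<circ> transpose a b) = - sign p" "sign (transpose a b \<circ> p) = - sign p"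
proof -
  have "permutation p" using assms(1) by (rule permutes_imp_permutation[rotated]) simp
  then show "sign (p \<circ> transpose a b) = - sign p" "sign (transpose a b \<circ> p) = - sign p"
    using assms(2) by (simp_all add: sign_compose permutation_swap_id sign_swap_id)
qed

lemma alternating_sum_zero_transpose:
  fixes F :: "(nat \<Rightarrow> nat) \<Rightarrow> complex"
  assumes "a < n" "b < n" "a \<noteq> b"
    and "\<And>p. p permutes {..<n} \<Longrightarrow> F (p \<circ> transpose a b) = F p"
  shows "(\<Sum>p | p permutes {..<n}. of_int (sign p) * F p) = 0"
  by (rule alternating_sum_zero[where g = "\<lambda>p. p \<circ> transpose a b"])
     (use assms in \<open>auto simp: comp_assoc sign_compose_transpose intro!: permutes_compose permutes_swap_id\<close>)

lemma nested_diff: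
  assumes "k < n div 2"
  shows "nested n (H(k := \<lambda>a b. f a b - g a b)) = nested n (H(k := f)) - nested n (H(k := g))"
proof -
  have *: "(\<Prod>l<n div 2. (H(k := w)) l (p l) (p (n - Suc l)))
      = w (p k) (p (n - Suc k)) * (\<Prod>l\<in>{..<n div 2} - {k}. H l (p l) (p (n - Suc l)))" for w p
    using assms by (subst prod.remove[of _ k]) (auto intro!: prod.cong)
  show ?thesis
    unfolding nested_def * sum_subtractf[symmetric] by (intro sum.cong) (auto simp: algebra_simps)
qed

text \<open>The factors are exchanged one at a time, so at each stage the remaining factors are a
  mixture of \<open>V\<close> and \<open>W\<close>. The arbitrary \<open>H\<close> stands for this
  mixture.\<close>

lemma nested_eqI:
  assumes "\<And>l H. l < n div 2 \<Longrightarrow> nested n (H(l := \<lambda>a b. V l a b - W l a b)) = 0"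
  shows "nested n V = nested n W"
proof -
  have "nested n (\<lambda>l. if l < k then W l else V l) = nested n V" if "k \<le> n div 2" for k
    using that
  proof (induction k)
    case (Suc k)
    define H where "H = (\<lambda>l. if l < k then W l else V l)"
    have "H(k := V k) = H" "H(k := W k) = (\<lambda>l. if l < Suc k then W l else V l)"
      by (auto simp: H_def)
    moreover have "nested n (H(k := V k)) - nested n (H(k := W k)) = 0"
      using nested_diff[of k n H "V k" "W k"] assms[of k H] Suc.prems by simp
    ultimately have "nested n H - nested n (\<lambda>l. if l < Suc k then W l else V l) = 0" by simp
    then have "nested n (\<lambda>l. if l < Suc k then W l else V l) = nested n H" by simp
    also have "\<dots> = nested n V" unfolding H_def using Suc by (intro Suc.IH) auto
    finally show ?case .
  qed simp
  from this[of "n div 2"] have "nested n V = nested n (\<lambda>l. if l < n div 2 then W l else V l)" by simp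
  also have "\<dots> = nested n W"
    unfolding nested_def by (intro sum.cong arg_cong2[of _ _ _ _ "(*)"] prod.cong) auto
  finally show ?thesis .
qed

text \<open>Exchanging the two positions of pair \<open>l\<close> is an odd move that changes no
  factor.\<close>

lemma nested_symmetric_zero:
  assumes "l < n div 2" "\<And>a b. f a b = f b a"
  shows "nested n (H(l := f)) = 0"
  unfolding nested_def
proof (rule alternating_sum_zero_transpose[of l _ "n - Suc l"])
  fix p assume "p permutes {..<n}"
  show "(\<Prod>k<n div 2. (H(l := f)) k ((p \<circ> transpose l (n - Suc l)) k) ((p \<circ> transpose l (n - Suc l)) (n - Suc k)))
      = (\<Prod>k<n div 2. (H(l := f)) k (p k) (p (n - Suc k)))"
    by (intro prod.cong) (use assms in \<open>auto simp: transpose_def\<close>)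
qed (use assms in auto)

lemma odd_mirror_index:
  assumes "odd n" "k < n div 2"
  shows "n - Suc k \<noteq> n div 2" "n div 2 < n - Suc k" "n - Suc k < n" "n div 2 < n" "k < n - Suc k"
  using assms by (auto elim!: oddE)

text \<open>For odd \<open>n\<close> the middle position belongs to no pair. If a factor depends on
  only one entry of its pair, the other entry can be exchanged with the middle one: an odd move that
  changes no factor. This removes the linear term.\<close>

lemma nested_unary_zero:
  assumes "l < n div 2" "odd n"
  shows "nested n (H(l := \<lambda>a b. u a - u b)) = 0"
proof -
  have "nested n (H(l := \<lambda>a b. u a)) = 0"
    unfolding nested_def
  proof (rule alternating_sum_zero_transpose[of "n - Suc l" _ "n div 2"])
    fix p assume "p permutes {..<n}"
    show "(\<Prod>k<n div 2. (H(l := \<lambda>a b. u a)) k ((p \<circ> transpose (n - Suc l) (n div 2)) k) ((p \<circ> transpose (n - Suc l) (n div 2)) (n - Suc k)))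
        = (\<Prod>k<n div 2. (H(l := \<lambda>a b. u a)) k (p k) (p (n - Suc k)))"
    proof (intro prod.cong refl)
      fix k assume "k \<in> {..<n div 2}"
      then have "transpose (n - Suc l) (n div 2) k = k" "k \<noteq> l \<Longrightarrow> transpose (n - Suc l) (n div 2) (n - Suc k) = n - Suc k"
        using odd_mirror_index[OF assms(2), of k] odd_mirror_index[OF assms(2,1)] assms(1)
        by (auto intro!: transpose_apply_other)
      then show "(H(l := \<lambda>a b. u a)) k ((p \<circ> transpose (n - Suc l) (n div 2)) k) ((p \<circ> transpose (n - Suc l) (n div 2)) (n - Suc k))
        = (H(l := \<lambda>a b. u a)) k (p k) (p (n - Suc k))" by simp
    qed
  qed (use odd_mirror_index[OF assms(2,1)] in auto)
  moreover have "nested n (H(l := \<lambda>a b. u b)) = 0"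
    unfolding nested_def
  proof (rule alternating_sum_zero_transpose[of l _ "n div 2"])
    fix p assume "p permutes {..<n}"
    show "(\<Prod>k<n div 2. (H(l := \<lambda>a b. u b)) k ((p \<circ> transpose l (n div 2)) k) ((p \<circ> transpose l (n div 2)) (n - Suc k)))
        = (\<Prod>k<n div 2. (H(l := \<lambda>a b. u b)) k (p k) (p (n - Suc k)))"
    proof (intro prod.cong refl)
      fix k assume "k \<in> {..<n div 2}"
      then have "transpose l (n div 2) (n - Suc k) = n - Suc k" "k \<noteq> l \<Longrightarrow> transpose l (n div 2) k = k"
        using odd_mirror_index[OF assms(2), of k] odd_mirror_index[OF assms(2,1)] assms(1)
        by (auto intro!: transpose_apply_other)
      then show "(H(l := \<lambda>a b. u b)) k ((p \<circ> transpose l (n div 2)) k) ((p \<circ> transpose l (n div 2)) (n - Suc k))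
        = (H(l := \<lambda>a b. u b)) k (p k) (p (n - Suc k))" by simp
    qed
  qed (use odd_mirror_index[OF assms(2,1)] assms in auto)
  ultimately show ?thesis using nested_diff[OF assms(1), of H "\<lambda>a b. u a" "\<lambda>a b. u b"] by simp
qed

section \<open>Evaluating the alternating sum of signs by splitting off pairs of adjacent
  values\<close>

definition sg :: "nat \<Rightarrow> nat \<Rightarrow> complex" where
  "sg a b = of_int (sgn (int b - int a))"

definition sg_term :: "nat \<Rightarrow> (nat \<Rightarrow> nat) \<Rightarrow> complex" where
  "sg_term n p = of_int (sign p) * (\<Prod>l<n div 2. sg (p l) (p (n - Suc l)))"

text \<open>The first \<open>k\<close> pairs of positions already carry the values (0,1), (2,3), and
  so on. Passing from \<open>k\<close> to \<open>Suc k\<close> gives a recursion that ends with a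
  single permutation.\<close>

definition fixing :: "nat \<Rightarrow> nat \<Rightarrow> (nat \<Rightarrow> nat) set" where
  "fixing n k = {p. p permutes {..<n} \<and> (\<forall>i<k. p i = 2 * i \<and> p (n - Suc i) = Suc (2 * i))}"

text \<open>Two adjacent values compare in the same way with every third value, so only a comparison
  of the two with each other would notice the exchange.\<close>

lemma sg_transpose:
  assumes "a \<noteq> b" "{a, b} \<noteq> {v, Suc v}"
  shows "sg (transpose v (Suc v) a) (transpose v (Suc v) b) = sg a b"
proof -
  have "transpose v (Suc v) a < transpose v (Suc v) b \<longleftrightarrow> a < b"
    using assms unfolding transpose_def by (cases "a = v"; cases "a = Suc v"; cases "b = v"; cases "b = Suc v") auto
  moreover have "transpose v (Suc v) a \<noteq> transpose v (Suc v) b"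
    using assms(1) by (metis transpose_involutory)
  ultimately show ?thesis using assms(1) unfolding sg_def by (simp add: sgn_if)
qed

text \<open>The transposition and the reversed comparison each contribute a factor -1.\<close>

lemma sg_term_swap:
  assumes "p permutes {..<n}" "l < n div 2"
  shows "sg_term n (p \<circ> transpose l (n - Suc l)) = sg_term n p"
proof -
  have *: "(\<Prod>k<n div 2. sg (q k) (q (n - Suc k)))
      = sg (q l) (q (n - Suc l)) * (\<Prod>k\<in>{..<n div 2} - {l}. sg (q k) (q (n - Suc k)))" for q
    using assms by (subst prod.remove[of _ l]) auto
  have "(\<Prod>k\<in>{..<n div 2} - {l}. sg ((p \<circ> transpose l (n - Suc l)) k) ((p \<circ> transpose l (n - Suc l)) (n - Suc k)))
     = (\<Prod>k\<in>{..<n div 2} - {l}. sg (p k) (p (n - Suc k)))"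
    using assms by (intro prod.cong) (auto simp: transpose_def)
  moreover have "sg (p (n - Suc l)) (p l) = - sg (p l) (p (n - Suc l))" by (simp add: sg_def sgn_if)
  then have "sg ((p \<circ> transpose l (n - Suc l)) l) ((p \<circ> transpose l (n - Suc l)) (n - Suc l)) = - sg (p l) (p (n - Suc l))"
    by simp
  moreover have "sign (p \<circ> transpose l (n - Suc l)) = - sign p"
    using assms by (intro sign_compose_transpose) auto
  ultimately show ?thesis
    unfolding sg_term_def * by simp
qed

text \<open>Exchanging two whole pairs takes two transpositions, an even permutation, and merely
  reorders the factors.\<close>

lemma sg_term_double_swap:
  assumes "p permutes {..<n}" "l < n div 2" "k < n div 2"
  shows "sg_term n (p \<circ> transpose l k \<circ> transpose (n - Suc l) (n - Suc k)) = sg_term n p"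
proof (cases "l = k")
  case False
  let ?q = "p \<circ> transpose l k \<circ> transpose (n - Suc l) (n - Suc k)"
  have "p \<circ> transpose l k permutes {..<n}"
    using assms by (intro permutes_compose[OF permutes_swap_id]) auto
  then have "sign ?q = - sign (p \<circ> transpose l k)"
    using assms False by (intro sign_compose_transpose) auto
  also have "\<dots> = sign p" using assms False by (simp add: sign_compose_transpose)
  finally have s: "sign ?q = sign p" .
  have "(\<Prod>i<n div 2. sg (?q i) (?q (n - Suc i)))
      = (\<Prod>i<n div 2. sg (p (transpose l k i)) (p (n - Suc (transpose l k i))))"
  proof (intro prod.cong refl arg_cong2[of _ _ _ _ sg])
    fix i assume i: "i \<in> {..<n div 2}"
    have "transpose (n - Suc l) (n - Suc k) i = i"
      using i assms by (intro transpose_apply_other) auto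
    then show "?q i = p (transpose l k i)" by simp
    have "transpose l k (transpose (n - Suc l) (n - Suc k) (n - Suc i)) = n - Suc (transpose l k i)"
    proof (cases "i = l \<or> i = k")
      case True
      then show ?thesis using assms by (auto intro!: transpose_apply_other)
    next
      case False
      then have "transpose (n - Suc l) (n - Suc k) (n - Suc i) = n - Suc i"
        using i assms by (intro transpose_apply_other) auto
      moreover have "transpose l k (n - Suc i) = n - Suc i"
        using i assms by (intro transpose_apply_other) auto
      ultimately show ?thesis using False by simp
    qed
    then show "?q (n - Suc i) = p (n - Suc (transpose l k i))" by simp
  qed
  also have "\<dots> = (\<Prod>i<n div 2. sg (p i) (p (n - Suc i)))"
    using assms prod.permute[OF permutes_swap_id[of l "{..<n div 2}" k], of "\<lambda>i. sg (p i) (p (n - Suc i))"]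
    by (simp add: o_def)
  finally show ?thesis using s by (simp add: sg_term_def)
qed simp

lemma finite_fixing: "finite (fixing n k)"
  unfolding fixing_def by (rule finite_subset[OF _ finite_permutations[of "{..<n}"]]) auto

lemma fixing_not_special:
  assumes "p \<in> fixing n k" "p q \<in> {2 * k, Suc (2 * k)}" "i < k"
  shows "q \<noteq> i" "q \<noteq> n - Suc i"
proof -
  have "p i = 2 * i" "p (n - Suc i) = Suc (2 * i)" using assms by (auto simp: fixing_def)
  moreover have "2 * i < 2 * k" "Suc (2 * i) < 2 * k" using assms(3) by auto
  ultimately show "q \<noteq> i" "q \<noteq> n - Suc i" using assms(2) by auto
qed

text \<open>The position \<open>q\<close> may lie in either half, so the two orientations of a pair
  are the sets for \<open>q\<close> and for \<open>n - Suc q\<close>.\<close>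

definition matched :: "nat \<Rightarrow> nat \<Rightarrow> nat \<Rightarrow> (nat \<Rightarrow> nat) set" where
  "matched n k q = {p \<in> fixing n k. p q = 2 * k \<and> p (n - Suc q) = Suc (2 * k)}"

definition unmatched :: "nat \<Rightarrow> nat \<Rightarrow> (nat \<Rightarrow> nat) set" where
  "unmatched n k = {p \<in> fixing n k. \<forall>q<n. \<not> (p q = 2 * k \<and> p (n - Suc q) = Suc (2 * k))}"

lemma fixing_permutes: "p \<in> fixing n k \<Longrightarrow> p permutes {..<n}"
  by (simp add: fixing_def)

lemma fixing_inj: "p \<in> fixing n k \<Longrightarrow> p i = p j \<longleftrightarrow> i = j"
  using permutes_inj[OF fixing_permutes] by (simp add: inj_eq)

lemma finite_matched: "finite (matched n k q)"
  unfolding matched_def using finite_fixing by auto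

text \<open>
  Exchanging the adjacent values \<open>2k\<close> and \<open>2k + 1\<close> changes no order relation between paired
  positions unless these two values are paired with each other.
\<close>

lemma sum_unmatched:
  assumes "k < n div 2"
  shows "(\<Sum>p\<in>unmatched n k. sg_term n p) = 0"
  unfolding sg_term_def
  proof (rule alternating_sum_zero[where g = "\<lambda>p. transpose (2 * k) (Suc (2 * k)) \<circ> p"])
    fix p assume p: "p \<in> unmatched n k"
    then have pf: "p \<in> fixing n k" and np: "\<And>q. q < n \<Longrightarrow> \<not> (p q = 2 * k \<and> p (n - Suc q) = Suc (2 * k))" by (auto simp: unmatched_def)
    let ?t = "transpose (2 * k) (Suc (2 * k))"
    show "sign (?t \<circ> p) = - sign p" using fixing_permutes[OF pf] by (simp add: sign_compose_transpose)
    have "?t \<circ> p permutes {..<n}"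
      using fixing_permutes[OF pf] assms by (intro permutes_compose[OF _ permutes_swap_id]) auto
    moreover have "?t (p i) = 2 * i \<and> ?t (p (n - Suc i)) = Suc (2 * i)" if "i < k" for i
    proof -
      have "p i = 2 * i" "p (n - Suc i) = Suc (2 * i)" using pf that by (simp_all add: fixing_def)
      moreover have "2 * i < 2 * k" "Suc (2 * i) < 2 * k" using that by auto
      ultimately show ?thesis by (simp add: transpose_apply_other)
    qed
    ultimately have "?t \<circ> p \<in> fixing n k" by (simp add: fixing_def)
    moreover have "\<not> (?t (p q) = 2 * k \<and> ?t (p (n - Suc q)) = Suc (2 * k))" if "q < n" for q
    proof -
      have "?t x = 2 * k \<longleftrightarrow> x = Suc (2 * k)" "?t x = Suc (2 * k) \<longleftrightarrow> x = 2 * k" for x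
        by (auto simp: transpose_def)
      moreover have "n - Suc (n - Suc q) = q" using that by simp
      ultimately show ?thesis using np[of "n - Suc q"] that by auto
    qed
    ultimately show "?t \<circ> p \<in> unmatched n k" by (simp add: unmatched_def)
    show "(\<Prod>l<n div 2. sg ((?t \<circ> p) l) ((?t \<circ> p) (n - Suc l))) = (\<Prod>l<n div 2. sg (p l) (p (n - Suc l)))"
    proof (intro prod.cong refl)
      fix l assume l: "l \<in> {..<n div 2}"
      then have ln: "l < n" "l \<noteq> n - Suc l" "n - Suc (n - Suc l) = l" by auto
      have "p l \<noteq> p (n - Suc l)" using fixing_inj[OF pf] ln(2) by blast
      moreover have "{p l, p (n - Suc l)} \<noteq> {2 * k, Suc (2 * k)}"
        using np[of l] np[of "n - Suc l"] ln unfolding doubleton_eq_iff by auto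
      ultimately show "sg ((?t \<circ> p) l) ((?t \<circ> p) (n - Suc l)) = sg (p l) (p (n - Suc l))"
        using sg_transpose by simp
    qed
qed (auto simp: comp_assoc[symmetric])

lemma sum_matched_swap:
  assumes q: "k \<le> q" "q < n div 2"
  shows "(\<Sum>p\<in>matched n k (n - Suc q). sg_term n p) = (\<Sum>p\<in>matched n k q. sg_term n p)"
proof -
  let ?g = "\<lambda>p :: nat \<Rightarrow> nat. p \<circ> transpose q (n - Suc q)"
  have "?g p \<in> fixing n k" if "p \<in> fixing n k" for p
  proof -
    have "?g p permutes {..<n}"
      using q fixing_permutes[OF that] by (intro permutes_compose[OF permutes_swap_id]) auto
    moreover have "transpose q (n - Suc q) i = i \<and> transpose q (n - Suc q) (n - Suc i) = n - Suc i" if "i < k" for i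
      using that q by (auto simp: transpose_def)
    ultimately show ?thesis using that by (simp add: fixing_def)
  qed
  then have "?g p \<in> matched n k (n - Suc q)" if "p \<in> matched n k q" for p
    using that q by (auto simp: matched_def Suc_diff_Suc)
  moreover have "?g p \<in> matched n k q" if "p \<in> matched n k (n - Suc q)" for p
    using that q \<open>\<And>p. p \<in> fixing n k \<Longrightarrow> ?g p \<in> fixing n k\<close> by (auto simp: matched_def Suc_diff_Suc)
  ultimately show ?thesis
    using sg_term_swap[OF fixing_permutes q(2)]
    by (intro sum.reindex_bij_witness[of _ ?g ?g]) (auto simp: comp_assoc matched_def)
qed

lemma sum_matched_move:
  assumes q: "k \<le> q" "q < n div 2"
  shows "(\<Sum>p\<in>matched n k q. sg_term n p) = (\<Sum>p\<in>matched n k k. sg_term n p)"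
proof -
  let ?g = "\<lambda>p :: nat \<Rightarrow> nat. p \<circ> transpose k q \<circ> transpose (n - Suc k) (n - Suc q)"
  have gg: "?g (?g p) = p" for p
  proof -
    have "k \<noteq> n - Suc k" "k \<noteq> n - Suc q" "q \<noteq> n - Suc k" "q \<noteq> n - Suc q" using q by auto
    then show ?thesis unfolding fun_eq_iff o_apply by (metis transpose_apply_first transpose_apply_second transpose_apply_other)
  qed
  have "?g p \<in> fixing n k" if "p \<in> fixing n k" for p
  proof -
    have "?g p permutes {..<n}"
      using q fixing_permutes[OF that] by (intro permutes_compose[OF permutes_swap_id]) auto
    moreover have "?g p i = p i" "?g p (n - Suc i) = p (n - Suc i)" if "i < k" for i
      using that q by (simp_all add: transpose_apply_other)
    ultimately show ?thesis using that by (simp add: fixing_def)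
  qed
  moreover have "?g p k = p q" "?g p q = p k" for p
    using q by (simp_all add: transpose_apply_other)
  moreover have "transpose k q (n - Suc q) = n - Suc q" "transpose k q (n - Suc k) = n - Suc k"
    using q by (simp_all add: transpose_apply_other)
  then have "?g p (n - Suc k) = p (n - Suc q)" "?g p (n - Suc q) = p (n - Suc k)" for p
    by simp_all
  ultimately show ?thesis
    using sg_term_double_swap[OF fixing_permutes _ q(2), of _ _ k] gg q
    by (intro sum.reindex_bij_witness[of _ ?g ?g]) (auto simp: matched_def simp del: o_apply)
qed

lemma matched_disjoint: "q \<noteq> r \<Longrightarrow> matched n k q \<inter> matched n k r = {}"
  using fixing_inj unfolding matched_def by fastforce

lemma fixing_split:
  assumes "k < n div 2"
  shows "fixing n k = unmatched n k \<union> (\<Union>q\<in>{k..<n div 2}. matched n k q \<union> matched n k (n - Suc q))"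
  proof (intro equalityI subsetI)
    fix p assume p: "p \<in> fixing n k"
    show "p \<in> unmatched n k \<union> (\<Union>q\<in>{k..<n div 2}. matched n k q \<union> matched n k (n - Suc q))"
    proof (cases "p \<in> unmatched n k")
      case False
      then obtain q where q: "q < n" "p q = 2 * k" "p (n - Suc q) = Suc (2 * k)" using p by (auto simp: unmatched_def)
      then have qn: "q \<noteq> n - Suc q" by auto
      have "q \<noteq> i \<and> q \<noteq> n - Suc i" if "i < k" for i using fixing_not_special[OF p _ that, of q] q by auto
      from this[of q] this[of "n - Suc q"] q(1) have "k \<le> q" "k \<le> n - Suc q"
        by (auto simp: not_less[symmetric])
      then have "q \<in> {k..<n div 2} \<or> n - Suc q \<in> {k..<n div 2}" using qn q(1) by auto
      moreover have "n - Suc (n - Suc q) = q" using q(1) by simp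
      moreover have "p \<in> matched n k q" using p q by (simp add: matched_def)
      ultimately show ?thesis by (metis (no_types, lifting) UN_I UnI1 UnI2)
    qed auto
  qed (use assms in \<open>auto simp: unmatched_def matched_def\<close>)

text \<open>The values \<open>2 * k\<close> and \<open>Suc (2 * k)\<close> can occupy any of the
  \<open>n div 2 - k\<close> free pairs in two orientations. All these choices contribute the same,
  and permutations that do not pair the two values cancel.\<close>

lemma sum_fixing_Suc:
  assumes "k < n div 2"
  shows "(\<Sum>p\<in>fixing n k. sg_term n p) = 2 * of_nat (n div 2 - k) * (\<Sum>p\<in>fixing n (Suc k). sg_term n p)"
proof -
  define B where "B = unmatched n k"
  define C where "C = matched n k"
  define Q where "Q = {k..<n div 2}"
  have Ck: "C k = fixing n (Suc k)"
    unfolding C_def matched_def fixing_def by (auto simp: less_Suc_eq)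
  note split = fixing_split[OF assms, folded B_def C_def Q_def]
  note disj = matched_disjoint[of _ _ n k, folded C_def] and fC = finite_matched[of n k, folded C_def]
  note swap = sum_matched_swap[of k _ n, folded C_def] and move = sum_matched_move[of k _ n, folded C_def]
  note B0 = sum_unmatched[OF assms, folded B_def]
  have finB: "finite B" using finite_fixing[of n k] by (simp add: B_def unmatched_def)
  have BC: "B \<inter> C q = {}" if "q < n" for q
    using that unfolding B_def C_def unmatched_def matched_def by blast
  have "(\<Sum>p\<in>fixing n k. sg_term n p) = (\<Sum>p\<in>B. sg_term n p) + (\<Sum>p\<in>(\<Union>q\<in>Q. C q \<union> C (n - Suc q)). sg_term n p)"
    unfolding split
  proof (rule sum.union_disjoint[OF finB])
    show "finite (\<Union>q\<in>Q. C q \<union> C (n - Suc q))" using fC by (simp add: Q_def)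
    have "q < n \<and> n - Suc q < n" if "q \<in> Q" for q using that by (auto simp: Q_def)
    then show "B \<inter> (\<Union>q\<in>Q. C q \<union> C (n - Suc q)) = {}" using BC by blast
  qed
  also have "\<dots> = (\<Sum>q\<in>Q. \<Sum>p\<in>C q \<union> C (n - Suc q). sg_term n p)"
    unfolding B0 add_0
  proof (rule sum.UNION_disjoint)
    show "\<forall>i\<in>Q. \<forall>j\<in>Q. i \<noteq> j \<longrightarrow> (C i \<union> C (n - Suc i)) \<inter> (C j \<union> C (n - Suc j)) = {}"
    proof (intro ballI impI)
      fix i j assume "i \<in> Q" "j \<in> Q" "i \<noteq> j"
      then have "i \<noteq> n - Suc j" "n - Suc i \<noteq> j" "n - Suc i \<noteq> n - Suc j" by (auto simp: Q_def)
      then show "(C i \<union> C (n - Suc i)) \<inter> (C j \<union> C (n - Suc j)) = {}" using disj \<open>i \<noteq> j\<close> by blast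
    qed
  qed (use fC Q_def in auto)
  also have "\<dots> = (\<Sum>q\<in>Q. 2 * (\<Sum>p\<in>fixing n (Suc k). sg_term n p))"
  proof (intro sum.cong refl)
    fix q assume "q \<in> Q"
    then have q: "k \<le> q" "q < n div 2" by (auto simp: Q_def)
    then have "(\<Sum>p\<in>C q \<union> C (n - Suc q). sg_term n p) = (\<Sum>p\<in>C q. sg_term n p) + (\<Sum>p\<in>C (n - Suc q). sg_term n p)"
      by (intro sum.union_disjoint disj fC) auto
    then show "(\<Sum>p\<in>C q \<union> C (n - Suc q). sg_term n p) = 2 * (\<Sum>p\<in>fixing n (Suc k). sg_term n p)"
      unfolding swap[OF q] move[OF q] Ck by simp
  qed
  finally show ?thesis by (simp add: Q_def)
qed

text \<open>Once all pairs are prescribed, only the middle position of an odd \<open>n\<close> is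
  left, and only the value \<open>n - 1\<close> is left for it.\<close>

lemma fixing_half: "\<exists>p. fixing n (n div 2) = {p}"
proof -
  define p where "p i = (if i < n div 2 then 2 * i else if n - n div 2 \<le> i \<and> i < n then Suc (2 * (n - Suc i)) else if i < n then n - Suc 0 else i)" for i
  have perm: "p permutes {..<n}"
  proof (rule inj_imp_permutes)
    show "inj_on p {..<n}" unfolding inj_on_def p_def by (auto split: if_splits) presburger+
    show "p i \<in> {..<n}" if "i \<in> {..<n}" for i using that unfolding p_def by (auto split: if_splits)
  qed (auto simp: p_def)
  have "p \<in> fixing n (n div 2)" using perm by (auto simp: fixing_def p_def)
  moreover have "r = p" if r: "r \<in> fixing n (n div 2)" for r
  proof
    fix i
    have rp: "r permutes {..<n}" and rv: "\<And>j. j < n div 2 \<Longrightarrow> r j = 2 * j \<and> r (n - Suc j) = Suc (2 * j)"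
      using r by (auto simp: fixing_def)
    have "i < n div 2 \<or> n - n div 2 \<le> i \<and> i < n \<or> n \<le> i \<or> i = n div 2 \<and> odd n" by presburger
    then consider "i < n div 2" | "n - n div 2 \<le> i" "i < n" | "i \<ge> n" | "i = n div 2" "odd n" by blast
    then show "r i = p i"
    proof cases
      case 1 then show ?thesis using rv by (simp add: p_def)
    next
      case 2 then show ?thesis using rv[of "n - Suc i"] by (auto simp: p_def Suc_diff_Suc)
    next
      case 3 then show ?thesis using rp by (simp add: p_def permutes_not_in)
    next
      case 4
      have "r i < n" using permutes_in_image[OF rp, of i] 4 by (auto elim!: oddE)
      moreover have "r i \<noteq> 2 * j \<and> r i \<noteq> Suc (2 * j)" if "j < n div 2" for j
      proof -
        have "r i \<noteq> r j" "r i \<noteq> r (n - Suc j)" using permutes_inj[OF rp] 4 that by (auto simp: inj_eq elim!: oddE)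
        then show ?thesis using rv[OF that] by auto
      qed
      then have "\<not> r i < 2 * (n div 2)"
        by (metis dvd_mult_div_cancel even_two_times_div_two less_mult_imp_div_less mult.commute odd_two_times_div_two_succ Suc_eq_plus1)
      ultimately have "r i = 2 * (n div 2)" using 4(2) by presburger
      then show ?thesis using 4 by (auto simp: p_def elim!: oddE)
    qed
  qed
  ultimately show ?thesis by blast
qed

text \<open>
  The sign is left open: the nonnegativity of the walk counts decides it in the end.
\<close>

lemma nested_sign:
  "nested n (\<lambda>l. sg) \<in> {2 ^ (n div 2) * fact (n div 2), - (2 ^ (n div 2) * fact (n div 2))}"
proof -
  have "nested n (\<lambda>l. sg) = (\<Sum>p\<in>fixing n 0. sg_term n p)"
    unfolding nested_def fixing_def sg_term_def by simp
  moreover have "k \<le> n div 2 \<Longrightarrow> (\<Sum>p\<in>fixing n (n div 2 - k). sg_term n p) = 2 ^ k * fact k * (\<Sum>p\<in>fixing n (n div 2). sg_term n p)" for k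
  proof (induction k)
    case (Suc k)
    have "Suc (n div 2 - Suc k) = n div 2 - k" "n div 2 - (n div 2 - Suc k) = Suc k" using Suc by auto
    then show ?case using sum_fixing_Suc[of "n div 2 - Suc k" n] Suc by simp
  qed simp
  from this[of "n div 2"] have "(\<Sum>p\<in>fixing n 0. sg_term n p) = 2 ^ (n div 2) * fact (n div 2) * (\<Sum>p\<in>fixing n (n div 2). sg_term n p)" by simp
  moreover have "(\<Sum>p\<in>fixing n (n div 2). sg_term n p) \<in> {1, -1}"
  proof -
    obtain p where p: "fixing n (n div 2) = {p}" using fixing_half by blast
    then have v: "p l = 2 * l \<and> p (n - Suc l) = Suc (2 * l)" if "l < n div 2" for l
      using that by (auto simp: fixing_def set_eq_iff)
    have "(\<Prod>l<n div 2. sg (p l) (p (n - Suc l))) = 1"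
      by (rule prod.neutral) (auto simp: v sg_def)
    then show ?thesis unfolding p by (auto simp: sg_term_def sign_def)
  qed
  ultimately show ?thesis by auto
qed

section \<open>Slater determinants\<close>

text \<open>
  The coefficient matrix of the monic Newton polynomials is unitriangular, and their values at
  the nodes form a triangular matrix.
\<close>

lemma vandermonde_det:
  fixes w :: "nat \<Rightarrow> 'a :: idom"
  shows "det (mat n n (\<lambda>(i, b). w b ^ i)) = (\<Prod>t<n. \<Prod>h<t. w t - w h)"
proof -
  define f where "f i = (\<Prod>r<i. [:- w r, 1:])" for i
  have deg: "degree (f i) = i" for i
    unfolding f_def by (subst degree_prod_eq_sum_degree) auto
  have lc: "coeff (f i) i = 1" for i
  proof -
    have "lead_coeff (f i) = 1" unfolding f_def lead_coeff_prod by simp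
    then show ?thesis by (simp add: deg)
  qed
  define U where "U = mat n n (\<lambda>(i, k). coeff (f i) k)"
  define V where "V = mat n n (\<lambda>(i, b). w b ^ i)"
  have U: "U \<in> carrier_mat n n" and V: "V \<in> carrier_mat n n" by (auto simp: U_def V_def)
  have entry: "(U * V) $$ (i, b) = (\<Prod>r<i. w b - w r)" if "i < n" "b < n" for i b
  proof -
    have "(U * V) $$ (i, b) = (\<Sum>k = 0..<n. coeff (f i) k * w b ^ k)"
      using that U V by (simp add: scalar_prod_def U_def V_def)
    also have "\<dots> = (\<Sum>k \<le> degree (f i). coeff (f i) k * w b ^ k)"
      using that deg[of i] by (intro sum.mono_neutral_right) (auto simp: coeff_eq_0)
    also have "\<dots> = poly (f i) (w b)" by (simp add: poly_altdef)
    finally show ?thesis by (simp add: f_def poly_prod)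
  qed
  have dU: "det U = 1"
  proof -
    have "det U = prod_list (diag_mat U)"
      by (rule det_lower_triangular[OF _ U]) (use deg in \<open>auto simp: U_def coeff_eq_0\<close>)
    also have "diag_mat U = map (\<lambda>i. 1) [0..<n]"
      using U lc by (auto simp: diag_mat_def U_def)
    finally show ?thesis by (simp add: map_replicate_const)
  qed
  have "det (U * V) = prod_list (diag_mat (U * V))"
  proof (rule det_upper_triangular)
    show "U * V \<in> carrier_mat n n" using U V by auto
    show "upper_triangular (U * V)"
    proof (rule upper_triangularI)
      fix i j assume ij: "j < i" "i < dim_row (U * V)"
      then have "i < n" using U by simp
      then have "(U * V) $$ (i, j) = (\<Prod>r<i. w j - w r)" using ij entry by simp
      also have "\<dots> = 0" using ij by (intro prod_zero) auto
      finally show "(U * V) $$ (i, j) = 0" .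
    qed
  qed
  also have "diag_mat (U * V) = map (\<lambda>i. \<Prod>r<i. w i - w r) [0..<n]"
    using U V entry by (auto simp: diag_mat_def)
  also have "prod_list \<dots> = (\<Prod>t<n. \<Prod>h<t. w t - w h)"
    by (simp add: prod.distinct_set_conv_list[symmetric] atLeast0LessThan)
  finally show ?thesis using det_mult[OF U V] dU by (simp add: V_def)
qed

text \<open>Each index lies in \<open>n - 1\<close> unordered pairs. This distributes factors pulled
  out of the columns over the factors of a Vandermonde product.\<close>

lemma prod_pairs:
  fixes v :: "nat \<Rightarrow> 'a :: comm_monoid_mult"
  shows "(\<Prod>t<n. \<Prod>h<t. v t * v h) = (\<Prod>b<n. v b ^ (n - 1))"
proof (induction n)
  case (Suc n)
  have "(\<Prod>b<n. v b ^ (n - 1)) * (\<Prod>b<n. v b) = (\<Prod>b<n. v b ^ n)"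
    unfolding prod.distrib[symmetric]
    by (intro prod.cong refl) (metis Suc_pred' lessThan_iff less_nat_zero_code mult.commute neq0_conv power_Suc)
  then show ?case using Suc by (simp add: prod.distrib ac_simps)
qed simp

lemma prod_pairs_const:
  fixes c :: "'a :: comm_monoid_mult"
  shows "(\<Prod>t<n. \<Prod>h<t. c) = c ^ (n choose 2)"
  by (induction n) (auto simp: numeral_2_eq_2 power_add mult.commute)

section \<open>Symmetries, eigenvalue equation and closed form of Slater determinants\<close>

definition slater :: "nat \<Rightarrow> (nat \<Rightarrow> real) \<Rightarrow> (nat \<Rightarrow> int) \<Rightarrow> complex" where
  "slater n q x = (\<Sum>p | p permutes {..<n}. of_int (sign p) * (\<Prod>i<n. cis (q i * of_int (x (p i)))))"

lemma slater_det: "slater n q x = det (mat n n (\<lambda>(i, b). cis (q i * of_int (x b))))"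
  unfolding slater_def
  by (subst det_def'[of _ n])
     (auto simp: atLeast0LessThan[symmetric] permutes_in_image intro!: sum.cong prod.cong)

lemma slater_cong:
  assumes "\<And>i. i < n \<Longrightarrow> q i = q' i"
  shows "slater n q x = slater n q' x"
  unfolding slater_def using assms by (intro sum.cong arg_cong2[of _ _ _ _ "(*)"] prod.cong refl) auto

lemma slater_permute:
  assumes r: "r permutes {..<n}"
  shows "slater n (q \<circ> r) x = of_int (sign r) * slater n q x"
proof -
  have pr: "permutation r" using r by (rule permutes_imp_permutation[rotated]) simp
  have "slater n (q \<circ> r) x = (\<Sum>p | p permutes {..<n}. of_int (sign (p \<circ> r)) * (\<Prod>i<n. cis (q (r i) * of_int (x (p (r i))))))"
    unfolding slater_def by (subst sum_permutations_compose_right[OF r]) simp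
  also have "\<dots> = (\<Sum>p | p permutes {..<n}. of_int (sign r) * (of_int (sign p) * (\<Prod>i<n. cis (q i * of_int (x (p i))))))"
  proof (intro sum.cong refl)
    fix p assume "p \<in> {p. p permutes {..<n}}"
    then have "permutation p" by (auto intro: permutes_imp_permutation[rotated])
    then have "sign (p \<circ> r) = sign r * sign p" using pr by (simp add: sign_compose mult.commute)
    moreover have "(\<Prod>i<n. cis (q (r i) * of_int (x (p (r i))))) = (\<Prod>i<n. cis (q i * of_int (x (p i))))"
      using prod.permute[OF r, of "\<lambda>i. cis (q i * of_int (x (p i)))"] by (simp add: o_def)
    ultimately show "of_int (sign (p \<circ> r)) * (\<Prod>i<n. cis (q (r i) * of_int (x (p (r i)))))
      = of_int (sign r) * (of_int (sign p) * (\<Prod>i<n. cis (q i * of_int (x (p i)))))" by simp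
  qed
  finally show ?thesis by (simp add: slater_def sum_distrib_left)
qed

lemma slater_equal_rows:
  assumes "a < n" "b < n" "a \<noteq> b" "q a = q b"
  shows "slater n q x = 0"
proof -
  have "q \<circ> transpose a b = q" using assms(4) by (auto simp: fun_eq_iff transpose_def)
  then have "slater n q x = - slater n q x"
    using slater_permute[OF permutes_swap_id[of a "{..<n}" b], of q x] assms by (simp add: sign_swap_id)
  then show ?thesis by (simp add: eq_neg_iff_add_eq_0 flip: mult_2)
qed

text \<open>Every Leibniz term has exactly one entry from column \<open>a\<close>, which may be
  replaced by the entry from column \<open>b\<close> in the same row at the cost of the factor
  \<open>c\<close>. After that, a permutation and its composite with the transposition of
  \<open>a\<close> and \<open>b\<close> have equal products and opposite signs.\<close>

lemma slater_proportional_columns: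
  assumes ab: "a < n" "b < n" "a \<noteq> b"
    and c: "\<And>i. i < n \<Longrightarrow> cis (q i * of_int (x a)) = c * cis (q i * of_int (x b))"
  shows "slater n q x = 0"
  unfolding slater_def
proof (rule alternating_sum_zero[where g = "\<lambda>p. transpose a b \<circ> p"])
  fix p assume p: "p \<in> {p. p permutes {..<n}}"
  show "sign (transpose a b \<circ> p) = - sign p" using sign_compose_transpose[of p n a b] p ab by auto
  show tp: "transpose a b \<circ> p \<in> {p. p permutes {..<n}}"
    using p ab by (auto intro: permutes_compose[OF _ permutes_swap_id])
  have *: "(\<Prod>i<n. cis (q i * of_int (x (r i)))) = c * (\<Prod>i<n. cis (q i * of_int (x (if r i = a then b else r i))))"
    if r: "r permutes {..<n}" for r
  proof -
    have "(\<Prod>i<n. cis (q i * of_int (x (r i))))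
        = (\<Prod>i<n. (if r i = a then c else 1) * cis (q i * of_int (x (if r i = a then b else r i))))"
      using c by (intro prod.cong) auto
    also have "\<dots> = (\<Prod>i<n. if r i = a then c else 1) * (\<Prod>i<n. cis (q i * of_int (x (if r i = a then b else r i))))"
      by (rule prod.distrib)
    also have "(\<Prod>i<n. if r i = a then c else 1) = (\<Prod>i<n. if i = a then c else 1)"
      using prod.permute[OF r, of "\<lambda>i. if i = a then c else 1"] by (simp add: o_def)
    also have "\<dots> = c" using ab by simp
    finally show ?thesis .
  qed
  have "(if (transpose a b \<circ> p) i = a then b else (transpose a b \<circ> p) i) = (if p i = a then b else p i)" for i
    using ab(3) by (auto simp: transpose_def)
  then show "(\<Prod>i<n. cis (q i * of_int (x ((transpose a b \<circ> p) i)))) = (\<Prod>i<n. cis (q i * of_int (x (p i))))"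
    using *[of p] *[of "transpose a b \<circ> p"] p tp by simp
qed (auto simp: comp_assoc[symmetric])

text \<open>Each Leibniz term is an eigenfunction by itself: raising the coordinate
  \<open>p k\<close> multiplies only the factor of row \<open>k\<close>, namely by
  \<open>cis (q k)\<close>, and the sum over \<open>k\<close> does not depend on
  \<open>p\<close>.\<close>

lemma slater_step:
  "(\<Sum>j<n. slater n q (x(j := x j + 1))) = (\<Sum>i<n. cis (q i)) * slater n q x"
proof -
  have "(\<Sum>j<n. \<Prod>i<n. cis (q i * of_int ((x(j := x j + 1)) (p i)))) = (\<Sum>i<n. cis (q i)) * (\<Prod>i<n. cis (q i * of_int (x (p i))))"
    if p: "p permutes {..<n}" for p
  proof -
    have "(\<Sum>j<n. \<Prod>i<n. cis (q i * of_int ((x(j := x j + 1)) (p i))))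
        = (\<Sum>k<n. \<Prod>i<n. cis (q i * of_int ((x(p k := x (p k) + 1)) (p i))))"
      using sum.permute[OF p, of "\<lambda>j. \<Prod>i<n. cis (q i * of_int ((x(j := x j + 1)) (p i)))"] by (simp add: o_def)
    also have "\<dots> = (\<Sum>k<n. \<Prod>i<n. (if i = k then cis (q i) else 1) * cis (q i * of_int (x (p i))))"
      using permutes_inj[OF p] by (intro sum.cong prod.cong refl) (auto simp: inj_eq algebra_simps cis_mult)
    finally show ?thesis by (simp add: prod.distrib sum_distrib_right)
  qed
  then show ?thesis
    unfolding slater_def by (subst sum.swap) (auto simp: sum_distrib_left[symmetric] mult_ac sum_distrib_left intro!: sum.cong)
qed

text \<open>Taking \<open>u b ^ (n - 1)\<close> out of column \<open>b\<close> leaves powers of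
  \<open>w b\<close>, a Vandermonde matrix. Given back to the pairs, these factors make each
  difference of nodes symmetric, u_h/u_t - u_t/u_h, which is 2 i times a sine.\<close>

lemma slater_equidistant:
  "slater n (\<lambda>i. (real n - 1 - 2 * real i) * a) x = (\<Prod>t<n. \<Prod>h<t. 2 * \<i> * of_real (sin (a * of_int (x h - x t))))"
proof -
  define u where "u b = cis (a * of_int (x b))" for b
  define w where "w b = inverse (u b) ^ 2" for b
  have nz: "u b \<noteq> 0" for b by (simp add: u_def)
  have pair: "u t * u h * (w t - w h) = 2 * \<i> * of_real (sin (a * of_int (x h - x t)))" for t h
  proof -
    have "u t * u h * (w t - w h) = u h * inverse (u t) - u t * inverse (u h)"
      using nz[of t] nz[of h] by (simp add: w_def field_simps power2_eq_square)
    also have "\<dots> = cis (a * of_int (x h - x t)) - cis (- (a * of_int (x h - x t)))"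
      unfolding u_def cis_inverse cis_mult by (simp add: algebra_simps)
    also have "\<dots> = 2 * \<i> * of_real (sin (a * of_int (x h - x t)))"
      by (simp add: complex_eq_iff)
    finally show ?thesis .
  qed
  have "cis ((real n - 1 - 2 * real i) * a * of_int (x b)) = u b ^ (n - 1) * w b ^ i" if "i < n" for i b
  proof -
    have "u b ^ (n - 1) * w b ^ i = cis (real (n - 1) * (a * of_int (x b))) * cis (- (real (2 * i) * (a * of_int (x b))))"
      unfolding u_def w_def power_mult[symmetric] by (simp only: cis_inverse Complex.DeMoivre) simp
    also have "\<dots> = cis ((real n - 1 - 2 * real i) * a * of_int (x b))"
      unfolding cis_mult using that by (intro arg_cong[of _ _ cis]) (simp add: of_nat_diff algebra_simps)
    finally show ?thesis by simp
  qed
  then have "slater n (\<lambda>i. (real n - 1 - 2 * real i) * a) x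
      = (\<Sum>p | p permutes {..<n}. of_int (sign p) * ((\<Prod>i<n. u (p i) ^ (n - 1)) * (\<Prod>i<n. w (p i) ^ i)))"
    unfolding slater_def prod.distrib[symmetric] by (intro sum.cong arg_cong2[of _ _ _ _ "(*)"] prod.cong) auto
  also have "\<dots> = (\<Prod>b<n. u b ^ (n - 1)) * (\<Sum>p | p permutes {..<n}. of_int (sign p) * (\<Prod>i<n. w (p i) ^ i))"
    unfolding sum_distrib_left
  proof (intro sum.cong refl)
    fix p assume "p \<in> {p. p permutes {..<n}}"
    then have "(\<Prod>i<n. u (p i) ^ (n - 1)) = (\<Prod>b<n. u b ^ (n - 1))"
      using prod.permute[of p "{..<n}" "\<lambda>b. u b ^ (n - 1)"] by (simp add: o_def)
    then show "of_int (sign p) * ((\<Prod>i<n. u (p i) ^ (n - 1)) * (\<Prod>i<n. w (p i) ^ i))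
       = (\<Prod>b<n. u b ^ (n - 1)) * (of_int (sign p) * (\<Prod>i<n. w (p i) ^ i))" by simp
  qed
  also have "(\<Sum>p | p permutes {..<n}. of_int (sign p) * (\<Prod>i<n. w (p i) ^ i)) = det (mat n n (\<lambda>(i, b). w b ^ i))"
    by (subst det_def'[of _ n])
       (auto simp: atLeast0LessThan[symmetric] permutes_in_image intro!: sum.cong prod.cong)
  also have "\<dots> = (\<Prod>t<n. \<Prod>h<t. w t - w h)" by (rule vandermonde_det)
  also have "(\<Prod>b<n. u b ^ (n - 1)) = (\<Prod>t<n. \<Prod>h<t. u t * u h)" by (rule prod_pairs[symmetric])
  also have "\<dots> * (\<Prod>t<n. \<Prod>h<t. w t - w h) = (\<Prod>t<n. \<Prod>h<t. u t * u h * (w t - w h))"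
    by (simp add: prod.distrib)
  finally show ?thesis unfolding pair .
qed

section \<open>Expansion of the walk counts\<close>

lemma mirror_split:
  "{..<n} = {..<n div 2} \<union> (\<lambda>l. n - Suc l) ` {..<n div 2} \<union> (if odd n then {n div 2} else {})"
proof (intro equalityI subsetI)
  fix i assume i: "i \<in> {..<n}"
  have "i < n div 2 \<or> n - Suc i < n div 2 \<or> odd n \<and> i = n div 2" using i unfolding lessThan_iff by presburger
  then show "i \<in> {..<n div 2} \<union> (\<lambda>l. n - Suc l) ` {..<n div 2} \<union> (if odd n then {n div 2} else {})"
  proof (elim disjE)
    assume "n - Suc i < n div 2"
    moreover have "i = n - Suc (n - Suc i)" using i by simp
    ultimately show ?thesis by blast
  qed auto
qed (auto split: if_splits dest: odd_pos)

lemma prod_mirror: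
  fixes g :: "nat \<Rightarrow> 'a :: comm_monoid_mult"
  shows "(\<Prod>i<n. g i) = (\<Prod>l<n div 2. g l * g (n - Suc l)) * (if odd n then g (n div 2) else 1)"
proof -
  have "(\<Prod>i<n. g i) = (\<Prod>i\<in>{..<n div 2} \<union> (\<lambda>l. n - Suc l) ` {..<n div 2} \<union> (if odd n then {n div 2} else {}). g i)"
    using mirror_split[of n] by simp
  also have "\<dots> = (\<Prod>i\<in>{..<n div 2} \<union> (\<lambda>l. n - Suc l) ` {..<n div 2}. g i) * (\<Prod>i\<in>(if odd n then {n div 2} else {}). g i)"
    by (rule prod.union_disjoint) (auto elim!: oddE)
  also have "(\<Prod>i\<in>{..<n div 2} \<union> (\<lambda>l. n - Suc l) ` {..<n div 2}. g i) = (\<Prod>l<n div 2. g l) * (\<Prod>i\<in>(\<lambda>l. n - Suc l) ` {..<n div 2}. g i)"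
    by (rule prod.union_disjoint) auto
  also have "(\<Prod>i\<in>(\<lambda>l. n - Suc l) ` {..<n div 2}. g i) = (\<Prod>l<n div 2. g (n - Suc l))"
    by (subst prod.reindex) (auto simp: inj_on_def)
  finally show ?thesis by (auto simp: prod.distrib)
qed

lemma sum_mirror:
  fixes g :: "nat \<Rightarrow> 'a :: comm_monoid_add"
  shows "(\<Sum>i<n. g i) = (\<Sum>l<n div 2. g l + g (n - Suc l)) + (if odd n then g (n div 2) else 0)"
proof -
  have "(\<Sum>i<n. g i) = (\<Sum>i\<in>{..<n div 2} \<union> (\<lambda>l. n - Suc l) ` {..<n div 2} \<union> (if odd n then {n div 2} else {}). g i)"
    using mirror_split[of n] by simp
  also have "\<dots> = (\<Sum>i\<in>{..<n div 2} \<union> (\<lambda>l. n - Suc l) ` {..<n div 2}. g i) + (\<Sum>i\<in>(if odd n then {n div 2} else {}). g i)"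
    by (rule sum.union_disjoint) (auto elim!: oddE)
  also have "(\<Sum>i\<in>{..<n div 2} \<union> (\<lambda>l. n - Suc l) ` {..<n div 2}. g i) = (\<Sum>l<n div 2. g l) + (\<Sum>i\<in>(\<lambda>l. n - Suc l) ` {..<n div 2}. g i)"
    by (rule sum.union_disjoint) auto
  also have "(\<Sum>i\<in>(\<lambda>l. n - Suc l) ` {..<n div 2}. g i) = (\<Sum>l<n div 2. g (n - Suc l))"
    by (subst sum.reindex) (auto simp: inj_on_def)
  finally show ?thesis by (auto simp: sum.distrib)
qed

text \<open>An exponential of a coordinate difference gives opposite frequencies to the two
  positions of a pair. The middle position of an odd \<open>n\<close> has no factor, hence frequency
  0.\<close>

definition freq :: "nat \<Rightarrow> nat \<Rightarrow> (nat \<Rightarrow> nat) \<Rightarrow> nat \<Rightarrow> real" where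
  "freq n m t i = (if i < n div 2 then theta n m (t i)
                   else if n - n div 2 \<le> i then - theta n m (t (n - Suc i)) else 0)"

lemma freq_simps:
  "l < n div 2 \<Longrightarrow> freq n m t l = theta n m (t l)"
  "l < n div 2 \<Longrightarrow> freq n m t (n - Suc l) = - theta n m (t l)"
  "odd n \<Longrightarrow> freq n m t (n div 2) = 0"
  by (auto simp: freq_def elim!: oddE)

definition eigenvalue :: "nat \<Rightarrow> nat \<Rightarrow> (nat \<Rightarrow> nat) \<Rightarrow> real" where
  "eigenvalue n m t = real (n mod 2) + (\<Sum>l<n div 2. 2 * cos (theta n m (t l)))"

lemma sum_cis_freq: "(\<Sum>i<n. cis (freq n m t i)) = of_real (eigenvalue n m t)"
proof -
  have "cis a + cis (- a) = of_real (2 * cos a)" for a by (simp add: complex_eq_iff)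
  then show ?thesis
    by (subst sum_mirror) (auto simp: freq_simps eigenvalue_def odd_iff_mod_2_eq_one)
qed

lemma prod_cis_freq:
  "(\<Prod>l<n div 2. cis (theta n m (t l) * of_int (x (p l) - x (p (n - Suc l)))))
     = (\<Prod>i<n. cis (freq n m t i * of_int (x (p i))))"
  by (subst (2) prod_mirror) (auto simp: freq_simps cis_mult algebra_simps intro!: prod.cong)

text \<open>The alcove for integer points, with inequalities for all pairs instead of neighbours: a
  violation then directly names two columns to compare.\<close>

definition inside :: "nat \<Rightarrow> nat \<Rightarrow> (nat \<Rightarrow> int) \<Rightarrow> bool" where
  "inside n m x \<longleftrightarrow> (\<forall>a b. a < b \<longrightarrow> b < n \<longrightarrow> x b < x a \<and> x a - x b < int m)"

text \<open>The factor -i arises because each sine is replaced by -i times one exponential.\<close>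

definition amplitude :: "nat \<Rightarrow> nat \<Rightarrow> (nat \<Rightarrow> nat) \<Rightarrow> complex" where
  "amplitude n m t = (\<Prod>l<n div 2. - \<i> * of_real (2 / real m * cot (theta n m (t l) / 2)))"

abbreviation tuples :: "nat \<Rightarrow> nat \<Rightarrow> (nat \<Rightarrow> nat) set" where
  "tuples n m \<equiv> {..<n div 2} \<rightarrow>\<^sub>E {1..num_angles n m}"

lemma nested_cong:
  assumes "\<And>l a b. l < n div 2 \<Longrightarrow> a < n \<Longrightarrow> b < n \<Longrightarrow> V l a b = W l a b"
  shows "nested n V = nested n W"
  unfolding nested_def
proof (intro sum.cong refl arg_cong2[of _ _ _ _ "(*)"] prod.cong)
  fix p l assume p: "p \<in> {p. p permutes {..<n}}" and l: "l \<in> {..<n div 2}"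
  have "p l < n" "p (n - Suc l) < n"
    using permutes_in_image[of p "{..<n}"] p l by auto
  then show "V l (p l) (p (n - Suc l)) = W l (p l) (p (n - Suc l))" using assms l by auto
qed

text \<open>Inside the alcove the coordinates decrease, so \<open>sg a b\<close> is the sign of
  \<open>x a - x b\<close>. The series is odd in this difference, which extends its values from
  positive to negative differences and to 0.\<close>

lemma sg_eq_cot_sum:
  assumes "inside n m x" "a < n" "b < n"
  shows "sg a b = of_real (\<Sum>j=1..num_angles n m. 2 / real m * cot (theta n m j / 2) * sin (theta n m j * of_int (x a - x b)))
     + of_real (2 * real (n mod 2) * of_int (x a - x b) / real m)"
proof -
  define S where "S d = (\<Sum>j=1..num_angles n m. 2 / real m * cot (theta n m j / 2) * sin (theta n m j * of_int d))" for d
  have S: "S d = 1 - 2 * real (n mod 2) * of_int d / real m" if "0 < d" "d < int m" for d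
    using cot_sum[of "nat d" m n] that unfolding S_def by simp
  have odd: "S (- d) = - S d" for d
    unfolding S_def sum_negf[symmetric] by (intro sum.cong) auto
  consider "a < b" | "b < a" | "a = b" by linarith
  then show ?thesis unfolding S_def[symmetric]
  proof cases
    case 1
    then have "sg a b = 1" "x b < x a" "x a - x b < int m" using assms by (auto simp: sg_def inside_def)
    then show "sg a b = of_real (S (x a - x b)) + of_real (2 * real (n mod 2) * of_int (x a - x b) / real m)"
      using S[of "x a - x b"] by simp
  next
    case 2
    then have *: "sg a b = -1" "x a < x b" "x b - x a < int m" using assms by (auto simp: sg_def inside_def)
    have "S (x a - x b) = - S (x b - x a)" using odd[of "x b - x a"] by simp
    also have "S (x b - x a) = 1 - 2 * real (n mod 2) * of_int (x b - x a) / real m"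
      using S[of "x b - x a"] * by simp
    finally have "S (x a - x b) + 2 * real (n mod 2) * of_int (x a - x b) / real m = -1"
      by (simp add: diff_divide_distrib algebra_simps)
    then show "sg a b = of_real (S (x a - x b)) + of_real (2 * real (n mod 2) * of_int (x a - x b) / real m)"
      unfolding of_real_add[symmetric] * by simp
  next
    case 3
    then show "sg a b = of_real (S (x a - x b)) + of_real (2 * real (n mod 2) * of_int (x a - x b) / real m)"
      by (simp add: sg_def S_def)
  qed
qed

text \<open>Two corrections disappear under the alternating sum: the linear term, which is a
  difference \<open>u a - u b\<close>, and the cosine in sin y = -i cis y + i cos y, which is
  symmetric in \<open>a\<close> and \<open>b\<close>. With one exponential per angle left,
  multiplying out gives one Slater determinant per tuple of angles.\<close>

lemma nested_sg_expansion:
  assumes "inside n m x"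
  shows "nested n (\<lambda>l. sg) = (\<Sum>t\<in>tuples n m. amplitude n m t * slater n (freq n m t) x)"
proof -
  define c where "c j = 2 / real m * cot (theta n m j / 2)" for j
  define S :: "nat \<Rightarrow> nat \<Rightarrow> complex" where
    "S a b = of_real (\<Sum>j=1..num_angles n m. c j * sin (theta n m j * of_int (x a - x b)))" for a b
  define T where "T a b = (\<Sum>j=1..num_angles n m. - \<i> * of_real (c j) * cis (theta n m j * of_int (x a - x b)))" for a b
  define u :: "nat \<Rightarrow> complex" where "u a = of_real (2 * real (n mod 2) * of_int (x a) / real m)" for a
  have "nested n (\<lambda>l. sg) = nested n (\<lambda>l a b. S a b + (u a - u b))"
    using sg_eq_cot_sum[OF assms]
    by (intro nested_cong) (simp add: S_def c_def u_def diff_divide_distrib right_diff_distrib)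
  also have "\<dots> = nested n (\<lambda>l. S)"
  proof (rule nested_eqI)
    fix l H assume l: "l < n div 2"
    have "nested n (H(l := \<lambda>a b. u a - u b)) = 0"
    proof (cases "odd n")
      case True then show ?thesis using nested_unary_zero l by blast
    next
      case False then have "u a = 0" for a by (simp add: u_def)
      then show ?thesis using nested_symmetric_zero[OF l, of "\<lambda>a b. u a - u b"] by simp
    qed
    then show "nested n (H(l := \<lambda>a b. S a b + (u a - u b) - S a b)) = 0" by simp
  qed
  also have "\<dots> = nested n (\<lambda>l. T)"
  proof (rule nested_eqI)
    fix l H assume l: "l < n div 2"
    show "nested n (H(l := \<lambda>a b. S a b - T a b)) = 0"
    proof (rule nested_symmetric_zero[OF l])
      have "S a b - T a b = (\<Sum>j=1..num_angles n m. \<i> * of_real (c j * cos (theta n m j * of_int (x a - x b))))" for a b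
        unfolding S_def T_def of_real_sum sum_subtractf[symmetric]
        by (intro sum.cong) (auto simp: complex_eq_iff)
      moreover have "cos (theta n m j * of_int (x a - x b)) = cos (theta n m j * of_int (x b - x a))" for a b j
        using cos_minus[of "theta n m j * of_int (x a - x b)"] by (simp add: algebra_simps)
      ultimately show "S a b - T a b = S b a - T b a" for a b by presburger
    qed
  qed
  also have "\<dots> = (\<Sum>p | p permutes {..<n}. \<Sum>t\<in>tuples n m. amplitude n m t * (of_int (sign p) * (\<Prod>i<n. cis (freq n m t i * of_int (x (p i))))))"
    unfolding nested_def
  proof (intro sum.cong refl)
    fix p
    have "(\<Prod>l<n div 2. T (p l) (p (n - Suc l)))
        = (\<Sum>t\<in>tuples n m. \<Prod>l<n div 2. - \<i> * of_real (c (t l)) * cis (theta n m (t l) * of_int (x (p l) - x (p (n - Suc l)))))"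
      unfolding T_def by (rule prod_sum_PiE) auto
    also have "\<dots> = (\<Sum>t\<in>tuples n m. amplitude n m t * (\<Prod>i<n. cis (freq n m t i * of_int (x (p i)))))"
      unfolding prod.distrib prod_cis_freq amplitude_def c_def by (rule refl)
    finally show "of_int (sign p) * (\<Prod>l<n div 2. T (p l) (p (n - Suc l)))
      = (\<Sum>t\<in>tuples n m. amplitude n m t * (of_int (sign p) * (\<Prod>i<n. cis (freq n m t i * of_int (x (p i))))))"
      by (simp add: sum_distrib_left mult.left_commute)
  qed
  also have "\<dots> = (\<Sum>t\<in>tuples n m. amplitude n m t * slater n (freq n m t) x)"
    unfolding slater_def sum_distrib_left by (rule sum.swap)
  finally show ?thesis .
qed

text \<open>The point is that the value is the same for all rows \<open>i\<close>, so shifting a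
  coordinate by \<open>m\<close> rescales its whole column.\<close>

lemma freq_period:
  assumes "0 < m" "i < n"
  shows "cis (freq n m t i * real m) = (if even n then -1 else 1)"
proof -
  have th: "theta n m j * real m = (2 * real j - 1 + real (n mod 2)) * pi" for j
    using assms by (simp add: theta_def)
  have c: "cis ((2 * real j - 1 + real (n mod 2)) * pi) = (if even n then -1 else 1)" for j
  proof (cases "even n")
    case True
    then have *: "(2 * real j - 1 + real (n mod 2)) * pi = 2 * real j * pi - pi" by (simp add: algebra_simps)
    have "cis (2 * real j * pi - pi) = - 1"
      unfolding complex_eq_iff cis.sel cos_diff sin_diff cos_2npi sin_2npi by simp
    then show ?thesis using True unfolding * by simp
  next
    case False
    then have *: "(2 * real j - 1 + real (n mod 2)) * pi = 2 * real j * pi"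
      by (simp add: odd_iff_mod_2_eq_one)
    have "cis (2 * real j * pi) = 1"
      unfolding complex_eq_iff cis.sel cos_2npi sin_2npi by simp
    then show ?thesis using False unfolding * by simp
  qed
  have "cis (- a) = cnj (cis a)" for a by (simp add: complex_eq_iff)
  then have "cis (- (theta n m j * real m)) = (if even n then -1 else 1)" for j using th c by simp
  moreover have "even n \<Longrightarrow> i < n div 2 \<or> n - n div 2 \<le> i" by (auto elim!: evenE)
  ultimately show ?thesis using th c by (auto simp: freq_def)
qed

text \<open>
  A step out of the alcove makes two coordinates equal or different by \<open>m\<close>, so that two columns
  of the determinant become proportional.
\<close>

lemma slater_outside:
  assumes "inside n m x" "j < n" "1 \<le> m" and y: "y = x(j := x j + 1)" and out: "\<not> inside n m y"
  shows "slater n (freq n m t) y = 0"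
proof -
  obtain a b where ab: "a < b" "b < n" "\<not> (y b < y a \<and> y a - y b < int m)" using out by (auto simp: inside_def)
  have x: "x b < x a" "x a - x b < int m" using ab assms(1) by (auto simp: inside_def)
  \<comment> \<open>A unit step on integers can reach one of the two strict bounds but cannot jump
    over it.\<close>
  then consider "y a = y b" | "y a = y b + int m" using ab y by (fastforce split: if_splits)
  then show ?thesis
  proof cases
    case 1
    then show ?thesis using ab by (intro slater_proportional_columns[of a n b _ _ 1]) auto
  next
    case 2
    then have "cis (freq n m t i * of_int (y a)) = (if even n then -1 else 1) * cis (freq n m t i * of_int (y b))" if "i < n" for i
      using freq_period[of m i n t] assms(3) that by (simp add: distrib_left cis_mult[symmetric] mult.commute)
    then show ?thesis using ab by (intro slater_proportional_columns[of a n b]) auto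
  qed
qed

lemma alcove_iff_inside:
  assumes "1 \<le> n" "1 \<le> m" "x \<in> carrier_vec n"
  shows "map_vec real_of_int x \<in> alcove n m \<longleftrightarrow> inside n m (\<lambda>i. x $ i)"
proof
  assume "map_vec real_of_int x \<in> alcove n m"
  then have step: "x $ Suc i < x $ i" if "Suc i < n" for i
    using assms(3) that by (auto simp: alcove_def)
  have wrap: "x $ 0 - int m < x $ (n - 1)"
  proof -
    have "real_of_int (x $ 0) - real m < real_of_int (x $ (n - 1))"
      using \<open>map_vec real_of_int x \<in> alcove n m\<close> assms by (auto simp: alcove_def)
    then show ?thesis by linarith
  qed
  have dec: "x $ (a + d) \<le> x $ a - int d" if "a + d < n" for a d
    using that
  proof (induction d)
    case (Suc d)
    then show ?case using step[of "a + d"] by simp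
  qed simp
  show "inside n m (\<lambda>i. x $ i)"
    unfolding inside_def
  proof (intro allI impI conjI)
    fix a b assume ab: "a < b" "b < n"
    show "x $ b < x $ a" using dec[of a "b - a"] ab by simp
    have "x $ a \<le> x $ 0" using dec[of 0 a] ab by simp
    moreover have "x $ (n - 1) \<le> x $ b" using dec[of b "n - 1 - b"] ab by simp
    ultimately show "x $ a - x $ b < int m" using wrap by simp
  qed
next
  assume i: "inside n m (\<lambda>i. x $ i)"
  have "real_of_int (x $ 0) - real m < real_of_int (x $ (n - 1))"
  proof (cases "n = 1")
    case False
    then have "x $ 0 - x $ (n - 1) < int m" using i assms by (auto simp: inside_def)
    then show ?thesis by linarith
  qed (use assms in simp)
  then show "map_vec real_of_int x \<in> alcove n m"
    using i assms by (auto simp: alcove_def inside_def)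
qed

section \<open>Walk counts by their first step, and their eigenfunction expansion\<close>

lemma walks_from_0: "a \<in> R \<Longrightarrow> walks_from S R a 0 = {[a]}"
  by (auto simp: walks_from_def length_Suc_conv)

lemma walks_from_Suc:
  assumes "a \<in> R" "R \<subseteq> carrier_vec n" "S \<subseteq> carrier_vec n"
  shows "walks_from S R a (Suc k) = (\<Union>s\<in>{s \<in> S. a + s \<in> R}. (#) a ` walks_from S R (a + s) k)"
proof (intro equalityI subsetI)
  fix p assume p: "p \<in> walks_from S R a (Suc k)"
  then obtain q where q: "p = a # q" "length q = k + 1"
    by (auto simp: walks_from_def length_Suc_conv)
  then have q0: "q ! 0 \<in> R" and qR: "set q \<subseteq> R" using p by (auto simp: walks_from_def)
  have all: "\<And>i. i < Suc k \<Longrightarrow> p ! Suc i - p ! i \<in> S" using p by (auto simp: walks_from_def)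
  have s: "q ! 0 - a \<in> S" using all[of 0] q by simp
  have "a \<in> carrier_vec n" "q ! 0 \<in> carrier_vec n" using q0 assms by auto
  then have e: "a + (q ! 0 - a) = q ! 0" by (intro eq_vecI) auto
  have "q \<in> walks_from S R (a + (q ! 0 - a)) k"
    unfolding e walks_from_def using q qR all[of "Suc _"] by auto
  then show "p \<in> (\<Union>s\<in>{s \<in> S. a + s \<in> R}. (#) a ` walks_from S R (a + s) k)"
    using s e q0 q(1) by auto
next
  fix p assume "p \<in> (\<Union>s\<in>{s \<in> S. a + s \<in> R}. (#) a ` walks_from S R (a + s) k)"
  then obtain s q where s: "s \<in> S" "a + s \<in> R" and q: "q \<in> walks_from S R (a + s) k" "p = a # q" by auto
  have "a \<in> carrier_vec n" "s \<in> carrier_vec n" using s assms by auto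
  then have e: "(a + s) - a = s" by (intro eq_vecI) auto
  have "p ! Suc i - p ! i \<in> S" if "i < Suc k" for i
    using that q s e by (cases i) (auto simp: walks_from_def)
  then show "p \<in> walks_from S R a (Suc k)"
    using q assms(1) by (auto simp: walks_from_def)
qed

lemma card_walks_from_Suc:
  assumes "a \<in> R" "R \<subseteq> carrier_vec n" "S \<subseteq> carrier_vec n" "finite S"
  shows "finite (walks_from S R a k)"
    and "card (walks_from S R a (Suc k)) = (\<Sum>s\<in>S. if a + s \<in> R then card (walks_from S R (a + s) k) else 0)"
proof -
  have fin: "finite (walks_from S R b k)" if "b \<in> R" for b k
    using that
  proof (induction k arbitrary: b)
    case 0 then show ?case by (simp add: walks_from_0)
  next
    case (Suc k)
    show ?case unfolding walks_from_Suc[OF Suc.prems assms(2,3)] using Suc.IH assms(4) by auto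
  qed
  show "finite (walks_from S R a k)" using fin assms(1) .
  have "card (walks_from S R a (Suc k)) = (\<Sum>s\<in>{s \<in> S. a + s \<in> R}. card ((#) a ` walks_from S R (a + s) k))"
    unfolding walks_from_Suc[OF assms(1-3)]
  proof (rule card_UN_disjoint)
    show "\<forall>s\<in>{s \<in> S. a + s \<in> R}. \<forall>s'\<in>{s \<in> S. a + s \<in> R}. s \<noteq> s' \<longrightarrow>
       (#) a ` walks_from S R (a + s) k \<inter> (#) a ` walks_from S R (a + s') k = {}"
    proof (intro ballI impI)
      fix s s' assume s: "s \<in> {s \<in> S. a + s \<in> R}" "s' \<in> {s \<in> S. a + s \<in> R}" "s \<noteq> s'"
      have c: "a \<in> carrier_vec n" "s \<in> carrier_vec n" "s' \<in> carrier_vec n" using s assms by auto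
      have "a + s \<noteq> a + s'"
      proof
        assume *: "a + s = a + s'"
        have "s $ i = s' $ i" if "i < n" for i
          using arg_cong[OF *, of "\<lambda>v. v $ i"] c that by auto
        then have "s = s'" using c by (intro eq_vecI) auto
        then show False using s by simp
      qed
      then show "(#) a ` walks_from S R (a + s) k \<inter> (#) a ` walks_from S R (a + s') k = {}"
        by (auto simp: walks_from_def)
    qed
  qed (use fin assms in auto)
  also have "\<dots> = (\<Sum>s\<in>{s \<in> S. a + s \<in> R}. card (walks_from S R (a + s) k))"
    by (intro sum.cong refl card_image) auto
  also have "\<dots> = (\<Sum>s\<in>S. if a + s \<in> R then card (walks_from S R (a + s) k) else 0)"
    using assms(4) by (intro sum.mono_neutral_cong_left) auto
  finally show "card (walks_from S R a (Suc k)) = (\<Sum>s\<in>S. if a + s \<in> R then card (walks_from S R (a + s) k) else 0)" .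
qed

lemma sum_standard_steps: "(\<Sum>s\<in>standard_steps n. f s) = (\<Sum>j<n. f (unit_vec n j))"
proof -
  have "standard_steps n = unit_vec n ` {..<n}" by (auto simp: standard_steps_def)
  moreover have "inj_on (unit_vec n :: nat \<Rightarrow> real vec) {..<n}"
    by (auto simp: inj_on_def)
  ultimately show ?thesis by (simp add: sum.reindex)
qed

lemma slater_cong_config:
  assumes "\<And>i. i < n \<Longrightarrow> x i = y i"
  shows "slater n q x = slater n q y"
  unfolding slater_def
proof (intro sum.cong refl arg_cong2[of _ _ _ _ "(*)"] prod.cong)
  fix p i assume "p \<in> {p. p permutes {..<n}}" "i \<in> {..<n}"
  then have "p i < n" using permutes_in_image[of p "{..<n}" i] by auto
  then show "cis (q i * of_int (x (p i))) = cis (q i * of_int (y (p i)))" using assms by simp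
qed

lemma inside_cong:
  assumes "\<And>i. i < n \<Longrightarrow> x i = y i"
  shows "inside n m x \<longleftrightarrow> inside n m y"
  unfolding inside_def using assms by auto

text \<open>Both sides obey the same recursion in the starting point. A neighbour outside the alcove
  has no walks, and there every Slater determinant vanishes, so the step operator can be applied
  with all \<open>n\<close> steps. The case \<open>k = 0\<close> is the expansion of the
  constant.\<close>

lemma walk_count_expansion:
  assumes "1 \<le> n" "1 \<le> m" "map_vec real_of_int x \<in> alcove n m"
  shows "nested n (\<lambda>l. sg) * of_nat (card (walks_from (standard_steps n) (alcove n m) (map_vec real_of_int x) k))
    = (\<Sum>t\<in>tuples n m. amplitude n m t * slater n (freq n m t) (\<lambda>i. x $ i) * of_real (eigenvalue n m t) ^ k)"
  using assms(3)
proof (induction k arbitrary: x)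
  case 0
  then have "x \<in> carrier_vec n" by (auto simp: alcove_def)
  then have "inside n m (\<lambda>i. x $ i)" using alcove_iff_inside assms 0 by blast
  then show ?case using 0 by (simp add: walks_from_0 nested_sg_expansion)
next
  case (Suc k)
  let ?N = "\<lambda>a. card (walks_from (standard_steps n) (alcove n m) a k)"
  have x: "x \<in> carrier_vec n" using Suc.prems by (auto simp: alcove_def)
  define y where "y j = x + unit_vec n j" for j
  have y: "y j \<in> carrier_vec n" "map_vec real_of_int x + unit_vec n j = map_vec real_of_int (y j)" if "j < n" for j
    using x that by (auto simp: y_def intro!: eq_vecI)
  have yx: "y j $ i = ((\<lambda>i. x $ i)(j := x $ j + 1)) i" if "j < n" "i < n" for i j
    using x that by (auto simp: y_def)
  have in_x: "inside n m (\<lambda>i. x $ i)" using alcove_iff_inside assms(1,2) x Suc.prems by blast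
  have step: "nested n (\<lambda>l. sg) * of_nat (if map_vec real_of_int (y j) \<in> alcove n m then ?N (map_vec real_of_int (y j)) else 0)
    = (\<Sum>t\<in>tuples n m. amplitude n m t * of_real (eigenvalue n m t) ^ k * slater n (freq n m t) ((\<lambda>i. x $ i)(j := x $ j + 1)))"
    if j: "j < n" for j
  proof -
    have sl: "slater n q ((\<lambda>i. x $ i)(j := x $ j + 1)) = slater n q (\<lambda>i. y j $ i)" for q
      using yx[OF j] by (intro slater_cong_config) auto
    have iff: "map_vec real_of_int (y j) \<in> alcove n m \<longleftrightarrow> inside n m ((\<lambda>i. x $ i)(j := x $ j + 1))"
      using alcove_iff_inside[OF assms(1,2) y(1)[OF j]] inside_cong[of n "\<lambda>i. y j $ i" "(\<lambda>i. x $ i)(j := x $ j + 1)"] yx[OF j] by auto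
    show ?thesis
    proof (cases "map_vec real_of_int (y j) \<in> alcove n m")
      case True
      then show ?thesis using Suc.IH[OF True] unfolding sl by (simp add: mult_ac)
    next
      case False
      then have "slater n (freq n m t) ((\<lambda>i. x $ i)(j := x $ j + 1)) = 0" for t
        using iff by (intro slater_outside[OF in_x j assms(2) refl]) auto
      then show ?thesis using False by simp
    qed
  qed
  have st: "standard_steps n \<subseteq> carrier_vec n" "finite (standard_steps n)" "alcove n m \<subseteq> carrier_vec n"
    by (auto simp: standard_steps_def alcove_def)
  have "card (walks_from (standard_steps n) (alcove n m) (map_vec real_of_int x) (Suc k))
      = (\<Sum>j<n. if map_vec real_of_int (y j) \<in> alcove n m then ?N (map_vec real_of_int (y j)) else 0)"
    using card_walks_from_Suc(2)[OF Suc.prems st(3,1,2), of k] y(2) by (simp add: sum_standard_steps cong: if_cong)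
  then have "nested n (\<lambda>l. sg) * of_nat (card (walks_from (standard_steps n) (alcove n m) (map_vec real_of_int x) (Suc k)))
      = (\<Sum>j<n. \<Sum>t\<in>tuples n m. amplitude n m t * of_real (eigenvalue n m t) ^ k * slater n (freq n m t) ((\<lambda>i. x $ i)(j := x $ j + 1)))"
    using step by (simp only: of_nat_sum sum_distrib_left) (intro sum.cong refl, simp)
  also have "\<dots> = (\<Sum>t\<in>tuples n m. amplitude n m t * of_real (eigenvalue n m t) ^ k * (\<Sum>j<n. slater n (freq n m t) ((\<lambda>i. x $ i)(j := x $ j + 1))))"
    by (subst sum.swap) (simp add: sum_distrib_left)
  also have "\<dots> = (\<Sum>t\<in>tuples n m. amplitude n m t * slater n (freq n m t) (\<lambda>i. x $ i) * of_real (eigenvalue n m t) ^ Suc k)"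
    unfolding slater_step sum_cis_freq by (simp add: mult_ac)
  finally show ?case .
qed

section \<open>Dominant eigenvalues\<close>

text \<open>Common elements cancel, and any bijection between the two differences compares the rest
  term by term. It is applied to cosines for the eigenvalues and to logarithms of cotangents for the
  coefficients.\<close>

lemma sum_less_of_separated:
  fixes g :: "'a \<Rightarrow> real"
  assumes "finite I" "finite T" "card I = card T" "I \<noteq> T"
    and less: "\<And>i j. i \<in> I - T \<Longrightarrow> j \<in> T - I \<Longrightarrow> g i < g j"
  shows "(\<Sum>i\<in>I. g i) < (\<Sum>j\<in>T. g j)"
proof -
  have c: "card (I - T) = card (T - I)"
    using assms(1-3) card_Diff_subset_Int[of I T] card_Diff_subset_Int[of T I] by (simp add: Int_commute)
  then obtain f where f: "bij_betw f (I - T) (T - I)"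
    using finite_same_card_bij[of "I - T" "T - I"] assms(1,2) by blast
  have ne: "I - T \<noteq> {}"
  proof
    assume "I - T = {}"
    then have "I \<subseteq> T" by blast
    then show False using assms(1-4) card_subset_eq[of T I] by simp
  qed
  have "(\<Sum>i\<in>I - T. g i) < (\<Sum>i\<in>I - T. g (f i))"
  proof (rule sum_strict_mono)
    fix i assume i: "i \<in> I - T"
    then show "g i < g (f i)" using bij_betw_apply[OF f i] by (rule less)
  qed (use assms(1) ne in auto)
  also have "\<dots> = (\<Sum>j\<in>T - I. g j)" by (rule sum.reindex_bij_betw[OF f])
  finally have "(\<Sum>i\<in>I - T. g i) < (\<Sum>j\<in>T - I. g j)" .
  moreover have "(\<Sum>i\<in>I. g i) = (\<Sum>i\<in>I \<inter> T. g i) + (\<Sum>i\<in>I - T. g i)"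
    by (rule sum.Int_Diff[OF assms(1)])
  moreover have "(\<Sum>i\<in>T. g i) = (\<Sum>i\<in>I \<inter> T. g i) + (\<Sum>i\<in>T - I. g i)"
    unfolding Int_commute[of I T] by (rule sum.Int_Diff[OF assms(2)])
  ultimately show ?thesis by linarith
qed

lemma cos_theta_less:
  assumes "i \<in> {1..num_angles n m}" "j \<in> {1..num_angles n m}" "i < j"
  shows "cos (theta n m j) < cos (theta n m i)"
proof (rule cos_monotone_0_pi)
  show "0 \<le> theta n m i" "theta n m j \<le> pi" using theta_bounds assms by (auto intro: less_imp_le)
  have "0 < m" using assms by (cases m) (auto simp: num_angles_def)
  then show "theta n m i < theta n m j" using assms by (simp add: theta_def divide_strict_right_mono)
qed

lemma cot_theta_pos:
  assumes "j \<in> {1..num_angles n m}"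
  shows "0 < cot (theta n m j / 2)"
  using theta_bounds[OF assms] theta_less_pi[OF assms] unfolding cot_def
  by (intro divide_pos_pos cos_gt_zero_pi sin_gt_zero) auto

lemma cot_theta_less:
  assumes "i \<in> {1..num_angles n m}" "j \<in> {1..num_angles n m}" "i < j"
  shows "cot (theta n m j / 2) < cot (theta n m i / 2)"
proof -
  have b: "0 < theta n m i" "theta n m j < pi" "0 < theta n m j" "theta n m i < pi"
    using theta_bounds theta_less_pi assms by auto
  have "0 < m" using assms by (cases m) (auto simp: num_angles_def)
  then have lt: "theta n m i < theta n m j" using assms by (simp add: theta_def divide_strict_right_mono)
  have "cos (theta n m j / 2) < cos (theta n m i / 2)" using b lt by (intro cos_monotone_0_pi) auto
  moreover have "sin (theta n m i / 2) < sin (theta n m j / 2)" using b lt by (intro sin_monotone_2pi) auto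
  moreover have "0 < sin (theta n m i / 2)" using b by (intro sin_gt_zero) auto
  moreover have "0 < cos (theta n m j / 2)" using b by (intro cos_gt_zero_pi) auto
  ultimately show ?thesis unfolding cot_def by (intro frac_less) auto
qed

section \<open>Grouping tuples by their set of angles\<close>

definition tuples_onto :: "nat \<Rightarrow> nat \<Rightarrow> nat set \<Rightarrow> (nat \<Rightarrow> nat) set" where
  "tuples_onto n m I = {t \<in> tuples n m. inj_on t {..<n div 2} \<and> t ` {..<n div 2} = I}"

lemma card_tuples_onto:
  assumes "I \<subseteq> {1..num_angles n m}" "card I = n div 2"
  shows "card (tuples_onto n m I) = fact (n div 2)"
proof -
  have fI: "finite I" using assms finite_subset by blast
  have "tuples_onto n m I = {t \<in> {..<n div 2} \<rightarrow>\<^sub>E I. inj_on t {..<n div 2}}"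
  proof (intro equalityI subsetI)
    fix t assume t: "t \<in> {t \<in> {..<n div 2} \<rightarrow>\<^sub>E I. inj_on t {..<n div 2}}"
    then have "t ` {..<n div 2} \<subseteq> I" "card (t ` {..<n div 2}) = n div 2" by (auto simp: card_image)
    then have "t ` {..<n div 2} = I" using assms fI by (intro card_subset_eq) auto
    then show "t \<in> tuples_onto n m I" using t assms by (auto simp: tuples_onto_def PiE_def Pi_def)
  qed (auto simp: tuples_onto_def PiE_def Pi_def)
  also have "card \<dots> = fact (n div 2)"
    using card_inj_on_subset_funcset[of "{..<n div 2}" I "{..<n div 2}"] fI assms
    by (simp add: fact_prod_rev)
  finally show ?thesis .
qed

text \<open>A transposition of angles acts on the rows of both halves in parallel, that is, by two
  transpositions, so no sign arises.\<close>

lemma slater_freq_permute: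
  assumes "p permutes {..<n div 2}"
  shows "slater n (freq n m (t \<circ> p)) x = slater n (freq n m t) x"
proof -
  \<comment> \<open>Quantified over \<open>t\<close> because the induction step uses the hypothesis
    for a tuple composed with a transposition.\<close>
  have "\<forall>t. slater n (freq n m (t \<circ> p)) x = slater n (freq n m t) x"
    using assms finite_lessThan
  proof (induction p rule: permutes_induct)
    case (swap a b p)
    show ?case
    proof
      fix t :: "nat \<Rightarrow> nat"
      define r where "r = transpose a b \<circ> transpose (n - Suc a) (n - Suc b)"
      have h: "a < n div 2" "b < n div 2" "a \<noteq> b" using swap(1-3) by auto
      then have ab: "a < n" "b < n" "n - Suc a \<noteq> n - Suc b" by auto
      have p1: "transpose a b permutes {..<n}" using ab by (intro permutes_swap_id) auto
      have p2: "transpose (n - Suc a) (n - Suc b) permutes {..<n}" using ab by (intro permutes_swap_id) auto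
      have r: "r permutes {..<n}" unfolding r_def by (rule permutes_compose[OF p2 p1])
      have "sign r = 1"
        using sign_compose_transpose(1)[OF p1 ab(3)] h(3) by (simp add: r_def sign_swap_id)
      have "freq n m (t \<circ> transpose a b) i = (freq n m t \<circ> r) i" if "i < n" for i
      proof -
        have "i < n div 2 \<or> n - Suc i < n div 2 \<or> odd n \<and> i = n div 2" using that by presburger
        then show ?thesis
        proof (elim disjE conjE)
          assume i: "i < n div 2"
          then have "transpose (n - Suc a) (n - Suc b) i = i"
            using h i by (intro transpose_apply_other) auto
          moreover have "transpose a b i < n div 2" using h i by (auto simp: transpose_def)
          ultimately show ?thesis using i by (simp add: r_def freq_simps)
        next
          define l where "l = n - Suc i"
          assume "n - Suc i < n div 2"
          then have l: "l < n div 2" "i = n - Suc l" using that by (auto simp: l_def)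
          have "transpose (n - Suc a) (n - Suc b) i = n - Suc (transpose a b l)"
          proof (cases "l = a \<or> l = b")
            case True then show ?thesis using l by auto
          next
            case False
            then have "transpose (n - Suc a) (n - Suc b) i = i"
              using h l by (intro transpose_apply_other) auto
            then show ?thesis using False l by simp
          qed
          moreover have l': "transpose a b l < n div 2" using h l by (auto simp: transpose_def)
          then have "transpose a b (n - Suc (transpose a b l)) = n - Suc (transpose a b l)"
            using h l' by (intro transpose_apply_other) auto
          ultimately have "r i = n - Suc (transpose a b l)" by (simp add: r_def)
          then show ?thesis using l l' by (simp add: freq_simps)
        next
          assume i: "odd n" "i = n div 2"
          have "transpose (n - Suc a) (n - Suc b) i = i" "transpose a b i = i"
            using odd_mirror_index[OF i(1) h(1)] odd_mirror_index[OF i(1) h(2)] h i by (auto intro!: transpose_apply_other)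
          then show ?thesis using i by (simp add: r_def freq_simps)
        qed
      qed
      then have "slater n (freq n m (t \<circ> transpose a b)) x = slater n (freq n m t \<circ> r) x"
        by (rule slater_cong)
      also have "\<dots> = slater n (freq n m t) x" using slater_permute[OF r] \<open>sign r = 1\<close> by simp
      finally show "slater n (freq n m (t \<circ> (transpose a b \<circ> p))) x = slater n (freq n m t) x"
        unfolding comp_assoc[symmetric] using swap.IH by metis
    qed
  qed simp
  then show ?thesis by blast
qed

lemma freq_cong: "(\<And>l. l < n div 2 \<Longrightarrow> s l = t l) \<Longrightarrow> freq n m s i = freq n m t i \<or> i \<ge> n"
  unfolding freq_def by auto

lemma slater_tuples_onto:
  assumes "t \<in> tuples_onto n m I" "inj_on s {..<n div 2}" "s ` {..<n div 2} = I"
  shows "slater n (freq n m t) x = slater n (freq n m s) x"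
proof -
  have bt: "bij_betw t {..<n div 2} I" and bs: "bij_betw s {..<n div 2} I"
    using assms by (auto simp: tuples_onto_def bij_betw_def)
  define p where "p l = (if l < n div 2 then inv_into {..<n div 2} s (t l) else l)" for l
  have "bij_betw (inv_into {..<n div 2} s \<circ> t) {..<n div 2} {..<n div 2}"
    using bij_betw_trans[OF bt bij_betw_inv_into[OF bs]] .
  then have "bij_betw p {..<n div 2} {..<n div 2}"
    by (rule iffD1[OF bij_betw_cong, rotated]) (simp add: p_def)
  then have p: "p permutes {..<n div 2}" by (rule bij_imp_permutes) (auto simp: p_def)
  have "t l = (s \<circ> p) l" if "l < n div 2" for l
    using that bt bs by (simp add: p_def bij_betw_inv_into_right[OF bs] bij_betw_apply)
  then have "slater n (freq n m t) x = slater n (freq n m (s \<circ> p)) x"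
    using freq_cong[of n t "s \<circ> p" m] by (intro slater_cong) (metis leD)
  then show ?thesis using slater_freq_permute[OF p] by simp
qed

lemma slater_not_inj:
  assumes "\<not> inj_on t {..<n div 2}"
  shows "slater n (freq n m t) x = 0"
proof -
  obtain a b where "a < n div 2" "b < n div 2" "a \<noteq> b" "t a = t b" using assms by (auto simp: inj_on_def)
  then show ?thesis by (intro slater_equal_rows[of a n b]) (auto simp: freq_simps)
qed

text \<open>All orderings of the same set of angles contribute equally; their number
  \<open>fact (n div 2)\<close> later cancels against \<open>nested_sign\<close>.\<close>

lemma sum_tuples_onto:
  assumes "I \<subseteq> {1..num_angles n m}" "inj_on s {..<n div 2}" "s ` {..<n div 2} = I"
  shows "(\<Sum>t\<in>tuples_onto n m I. amplitude n m t * slater n (freq n m t) x * of_real (eigenvalue n m t) ^ k)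
    = fact (n div 2) * ((- \<i>) ^ (n div 2) * of_real ((2 / real m) ^ (n div 2) * (\<Prod>j\<in>I. cot (theta n m j / 2))))
      * slater n (freq n m s) x * of_real (real (n mod 2) + (\<Sum>j\<in>I. 2 * cos (theta n m j))) ^ k"
proof -
  have cI: "card I = n div 2" using assms card_image by fastforce
  have "amplitude n m t * slater n (freq n m t) x * of_real (eigenvalue n m t) ^ k
    = ((- \<i>) ^ (n div 2) * of_real ((2 / real m) ^ (n div 2) * (\<Prod>j\<in>I. cot (theta n m j / 2))))
      * slater n (freq n m s) x * of_real (real (n mod 2) + (\<Sum>j\<in>I. 2 * cos (theta n m j))) ^ k"
    if t: "t \<in> tuples_onto n m I" for t
  proof -
    have b: "bij_betw t {..<n div 2} I" using t by (auto simp: tuples_onto_def bij_betw_def)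
    have "amplitude n m t = (\<Prod>j\<in>I. - \<i> * of_real (2 / real m * cot (theta n m j / 2)))"
      unfolding amplitude_def by (rule prod.reindex_bij_betw[OF b])
    also have "\<dots> = (- \<i>) ^ (n div 2) * of_real ((2 / real m) ^ (n div 2) * (\<Prod>j\<in>I. cot (theta n m j / 2)))"
      unfolding prod.distrib of_real_mult of_real_prod of_real_power by (simp add: cI mult.assoc)
    finally have a: "amplitude n m t = \<dots>" .
    have e: "eigenvalue n m t = real (n mod 2) + (\<Sum>j\<in>I. 2 * cos (theta n m j))"
      unfolding eigenvalue_def using sum.reindex_bij_betw[OF b, of "\<lambda>j. 2 * cos (theta n m j)"] by simp
    show ?thesis unfolding a e slater_tuples_onto[OF t assms(2,3)] ..
  qed
  then show ?thesis using card_tuples_onto[OF assms(1) cI] by (simp add: mult.assoc)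
qed

text \<open>Addition formulas with cos a < 1. The first inequality keeps the smallest eigenvalue
  above minus the largest for even \<open>n\<close> and odd \<open>m\<close>, the second does so if
  both are odd.\<close>

lemma sin_shift_less:
  fixes a :: real and n m :: nat
  assumes "1 \<le> n" "n < m" "a = pi / real m"
  shows "sin (real (n + 1) * a) < sin a + sin (real n * a)"
    and "sin (real (n - 1) * a) < sin a + sin (real n * a)"
proof -
  have a0: "0 < a" using assms by simp
  have "real n * a < real m * a" using a0 assms(2) by simp
  also have "\<dots> = pi" using assms by simp
  finally have na: "real n * a < pi" .
  have "a \<le> real n * a" using a0 assms(1) by simp
  with a0 na have a: "0 < a" "a < pi" "real n * a < pi" "0 < real n * a" by linarith+
  have sa: "0 < sin a" and sn: "0 < sin (real n * a)" using a by (auto intro: sin_gt_zero)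
  have ca: "cos a < 1" using cos_monotone_0_pi[of 0 a] a by simp
  have less: "sin (real n * a) * cos a < sin (real n * a)" using sn ca by simp
  have c: "cos (real n * a) * sin a \<le> sin a" "- sin a \<le> cos (real n * a) * sin a"
    using mult_right_mono[of "cos (real n * a)" 1 "sin a"] mult_right_mono[of "-1" "cos (real n * a)" "sin a"] sa by auto
  have "sin (real (n + 1) * a) = sin (real n * a) * cos a + cos (real n * a) * sin a"
    by (simp add: distrib_right sin_add)
  then show "sin (real (n + 1) * a) < sin a + sin (real n * a)" using less c by linarith
  have "sin (real (n - 1) * a) = sin (real n * a) * cos a - cos (real n * a) * sin a"
  proof -
    have "real (n - 1) * a = real n * a - a" using assms(1) by (simp add: of_nat_diff left_diff_distrib)
    then show ?thesis by (simp only: sin_diff)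
  qed
  then show "sin (real (n - 1) * a) < sin a + sin (real n * a)" using less c by linarith
qed

definition top_eigenvalue :: "nat \<Rightarrow> nat \<Rightarrow> real" where
  "top_eigenvalue n m = real (n mod 2) + (\<Sum>j=1..n div 2. 2 * cos (theta n m j))"

definition bottom :: "nat \<Rightarrow> nat \<Rightarrow> nat set" where
  "bottom n m = {Suc (num_angles n m) - n div 2..num_angles n m}"

definition bottom_eigenvalue :: "nat \<Rightarrow> nat \<Rightarrow> real" where
  "bottom_eigenvalue n m = real (n mod 2) + (\<Sum>j\<in>bottom n m. 2 * cos (theta n m j))"

lemma sin_top_eigenvalue: "sin (pi / real m) * top_eigenvalue n m = sin (real n * pi / real m)"
proof -
  have "2 * (n div 2) + n mod 2 = n" by simp
  then show ?thesis
    using dirichlet_kernel[of "n mod 2" "pi / real m" "n div 2"] by (simp add: top_eigenvalue_def theta_def)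
qed

lemma num_angles_ge:
  assumes "n \<le> m"
  shows "n div 2 \<le> num_angles n m"
  using assms unfolding num_angles_def by (metis diff_le_mono div_le_mono minus_mod_eq_mult_div mult.commute nonzero_mult_div_cancel_left zero_neq_numeral)

lemma bottom_subset: "n \<le> m \<Longrightarrow> bottom n m \<subseteq> {1..num_angles n m}"
  using num_angles_ge[of n m] by (auto simp: bottom_def)

lemma sum_bottom:
  assumes "n \<le> m"
  shows "(\<Sum>j\<in>bottom n m. f j) = (\<Sum>l=1..n div 2. f (Suc (num_angles n m) - l))"
  using num_angles_ge[OF assms] unfolding bottom_def
  by (intro sum.reindex_bij_witness[of _ "\<lambda>l. Suc (num_angles n m) - l" "\<lambda>j. Suc (num_angles n m) - j"]) auto

lemma prod_bottom:
  assumes "n \<le> m"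
  shows "(\<Prod>j\<in>bottom n m. f j) = (\<Prod>l=1..n div 2. f (Suc (num_angles n m) - l))"
  using num_angles_ge[OF assms] unfolding bottom_def
  by (intro prod.reindex_bij_witness[of _ "\<lambda>l. Suc (num_angles n m) - l" "\<lambda>j. Suc (num_angles n m) - j"]) auto

text \<open>The progression of angles read downwards: it starts pi/m below pi if \<open>n\<close>
  and \<open>m\<close> have the same parity, and 2 pi/m below pi otherwise.\<close>

lemma theta_reflect:
  assumes "1 \<le> l" "l \<le> num_angles n m" "0 < m"
  shows "2 * num_angles n m + n mod 2 = m \<Longrightarrow> theta n m (Suc (num_angles n m) - l) = pi - (2 * real l - 1) * (pi / real m)"
    and "2 * num_angles n m + n mod 2 \<noteq> m \<Longrightarrow> n mod 2 \<le> m \<Longrightarrow> theta n m (Suc (num_angles n m) - l) = pi - 2 * real l * (pi / real m)"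
proof -
  have e: "theta n m (Suc (num_angles n m) - l) = (real (2 * num_angles n m + n mod 2) + 1 - 2 * real l) * (pi / real m)"
    using assms by (simp add: theta_def of_nat_diff algebra_simps)
  {
    assume *: "2 * num_angles n m + n mod 2 = m"
    show "theta n m (Suc (num_angles n m) - l) = pi - (2 * real l - 1) * (pi / real m)"
      unfolding e * using assms by (simp add: field_simps)
  }
  {
    assume "2 * num_angles n m + n mod 2 \<noteq> m" "n mod 2 \<le> m"
    then have "Suc (2 * num_angles n m + n mod 2) = m" unfolding num_angles_def by presburger
    then have *: "real (2 * num_angles n m + n mod 2) = real m - 1" by linarith
    show "theta n m (Suc (num_angles n m) - l) = pi - 2 * real l * (pi / real m)"
      unfolding e * using assms by (simp add: field_simps)
  }
qed

lemma bottom_eigenvalue_even: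
  assumes "even n" "even m" "n \<le> m" "0 < m"
  shows "bottom_eigenvalue n m = - top_eigenvalue n m"
proof -
  have h: "2 * num_angles n m + n mod 2 = m" using assms by (simp add: num_angles_def)
  have "cos (theta n m (Suc (num_angles n m) - l)) = - cos (theta n m l)" if "l \<in> {1..n div 2}" for l
  proof -
    have "theta n m (Suc (num_angles n m) - l) = pi - (2 * real l - 1) * (pi / real m)"
      using theta_reflect(1)[OF _ _ _ h, of l] that num_angles_ge[OF assms(3)] assms by auto
    also have "(2 * real l - 1) * (pi / real m) = theta n m l" using assms by (simp add: theta_def)
    finally show ?thesis by (simp add: cos_diff)
  qed
  then show ?thesis
    using assms by (simp add: bottom_eigenvalue_def top_eigenvalue_def sum_bottom sum_negf)
qed

text \<open>Multiplied by sin a, the smallest eigenvalue becomes sin a - sin((n-1)a) for odd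
  \<open>n\<close> and \<open>m\<close>, sin a - sin((n+1)a) for even \<open>n\<close> and odd
  \<open>m\<close>, and 2 sin a - sin(na) for odd \<open>n\<close> and even \<open>m\<close>. Each
  of these exceeds -sin(na).\<close>

lemma bottom_eigenvalue_greater:
  assumes "1 \<le> n" "n < m" "\<not> (even n \<and> even m)"
  shows "- top_eigenvalue n m < bottom_eigenvalue n m"
proof -
  define a where "a = pi / real m"
  have "0 < a" "a < pi" using assms by (auto simp: a_def field_simps)
  then have sa: "0 < sin a" by (rule sin_gt_zero)
  have top: "sin a * top_eigenvalue n m = sin (real n * a)" using sin_top_eigenvalue[of m n] by (simp add: a_def)
  have hl: "l \<le> num_angles n m" if "l \<in> {1..n div 2}" for l using num_angles_ge[of n m] assms that by auto
  have "- (sin a * top_eigenvalue n m) < sin a * bottom_eigenvalue n m"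
  proof (cases "2 * num_angles n m + n mod 2 = m")
    case True
    then have odd: "odd n" using assms by presburger
    have "cos (theta n m (Suc (num_angles n m) - l)) = - cos ((2 * real l - 1) * a)" if "l \<in> {1..n div 2}" for l
      using theta_reflect(1)[OF _ hl[OF that] _ True] that assms by (simp add: a_def cos_diff)
    then have "bottom_eigenvalue n m = 1 - (\<Sum>l=1..n div 2. 2 * cos ((2 * real l - 1) * a))"
      using assms odd by (simp add: bottom_eigenvalue_def sum_bottom sum_negf odd_iff_mod_2_eq_one)
    moreover have "sin a * (\<Sum>l=1..n div 2. 2 * cos ((2 * real l - 1) * a)) = sin (real (n - 1) * a)"
      using dirichlet_kernel[of 0 a "n div 2"] odd by simp
    ultimately have "sin a * bottom_eigenvalue n m = sin a - sin (real (n - 1) * a)"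
      by (simp add: right_diff_distrib)
    then show ?thesis using sin_shift_less(2)[OF assms(1,2) a_def] top by linarith
  next
    case False
    have "n mod 2 \<le> m" using assms by (metis le_trans less_imp_le mod_less_eq_dividend)
    then have "cos (theta n m (Suc (num_angles n m) - l)) = - cos (2 * real l * a)" if "l \<in> {1..n div 2}" for l
      using theta_reflect(2)[OF _ hl[OF that] _ False] that assms by (simp add: a_def cos_diff)
    then have be: "bottom_eigenvalue n m = real (n mod 2) - (\<Sum>l=1..n div 2. 2 * cos (2 * real l * a))"
      using assms by (simp add: bottom_eigenvalue_def sum_bottom sum_negf)
    have "sin a * bottom_eigenvalue n m = (real (n mod 2) + 1) * sin a - sin a * (1 + (\<Sum>l=1..n div 2. 2 * cos (2 * real l * a)))"
      unfolding be by (simp add: algebra_simps)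
    also have "sin a * (1 + (\<Sum>l=1..n div 2. 2 * cos (2 * real l * a))) = sin (real (2 * (n div 2) + 1) * a)"
      using dirichlet_kernel[of 1 a "n div 2"] by simp
    finally have b: "sin a * bottom_eigenvalue n m = (real (n mod 2) + 1) * sin a - sin (real (2 * (n div 2) + 1) * a)" .
    show ?thesis
    proof (cases "even n")
      case True
      then show ?thesis using sin_shift_less(1)[OF assms(1,2) a_def] top b by simp
    next
      case odd: False
      then have "2 * (n div 2) + 1 = n" by simp
      then show ?thesis using top b sa odd by (simp add: odd_iff_mod_2_eq_one)
    qed
  qed
  then have "sin a * (- top_eigenvalue n m) < sin a * bottom_eigenvalue n m" by simp
  then show ?thesis using sa by (simp only: mult_less_cancel_left_pos)
qed

lemma eigenvalue_image:
  assumes "inj_on t {..<n div 2}"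
  shows "eigenvalue n m t = real (n mod 2) + (\<Sum>j\<in>t ` {..<n div 2}. 2 * cos (theta n m j))"
  unfolding eigenvalue_def using assms by (simp add: sum.reindex)

lemma eigenvalue_less_top:
  assumes "n \<le> m" "t \<in> tuples n m" "inj_on t {..<n div 2}" "t ` {..<n div 2} \<noteq> {1..n div 2}"
  shows "eigenvalue n m t < top_eigenvalue n m"
proof -
  let ?I = "t ` {..<n div 2}"
  have I: "?I \<subseteq> {1..num_angles n m}" using assms(2) by auto
  have "(\<Sum>j\<in>?I. 2 * cos (theta n m j)) < (\<Sum>j\<in>{1..n div 2}. 2 * cos (theta n m j))"
  proof (rule sum_less_of_separated)
    fix i j assume "i \<in> ?I - {1..n div 2}" "j \<in> {1..n div 2} - ?I"
    then have "i \<in> {1..num_angles n m}" "j \<in> {1..num_angles n m}" "j < i" using I num_angles_ge[OF assms(1)] by auto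
    then show "2 * cos (theta n m i) < 2 * cos (theta n m j)" using cos_theta_less by simp
  qed (use assms in \<open>auto simp: card_image\<close>)
  then show ?thesis by (simp add: eigenvalue_image[OF assms(3)] top_eigenvalue_def)
qed

lemma eigenvalue_greater_bottom:
  assumes "n \<le> m" "t \<in> tuples n m" "inj_on t {..<n div 2}" "t ` {..<n div 2} \<noteq> bottom n m"
  shows "bottom_eigenvalue n m < eigenvalue n m t"
proof -
  let ?I = "t ` {..<n div 2}"
  have I: "?I \<subseteq> {1..num_angles n m}" using assms(2) by auto
  have "(\<Sum>j\<in>bottom n m. 2 * cos (theta n m j)) < (\<Sum>j\<in>?I. 2 * cos (theta n m j))"
  proof (rule sum_less_of_separated)
    fix i j assume "i \<in> bottom n m - ?I" "j \<in> ?I - bottom n m"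
    then have "i \<in> {1..num_angles n m}" "j \<in> {1..num_angles n m}" "j < i"
      using I bottom_subset[OF assms(1)] by (auto simp: bottom_def)
    then show "2 * cos (theta n m i) < 2 * cos (theta n m j)" using cos_theta_less by simp
  qed (use assms num_angles_ge[OF assms(1)] in \<open>auto simp: card_image bottom_def\<close>)
  then show ?thesis by (simp add: eigenvalue_image[OF assms(3)] bottom_eigenvalue_def)
qed

lemma top_eigenvalue_pos:
  assumes "1 \<le> n" "n < m"
  shows "0 < top_eigenvalue n m"
proof -
  have "0 < sin (real n * pi / real m)" "0 < sin (pi / real m)"
    using assms by (auto intro!: sin_gt_zero simp: field_simps)
  then show ?thesis using sin_top_eigenvalue[of m n] by (metis zero_less_mult_pos)
qed

text \<open>Logarithms turn the products into comparable sums. Strictness comes from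
  \<open>n < m\<close>, which makes the smallest and the largest angles different sets; it keeps the
  oscillating bracket of the asymptotics away from 0.\<close>

lemma prod_cot_bottom_less:
  assumes "2 \<le> n" "even n" "even m" "n < m"
  shows "(\<Prod>j\<in>bottom n m. cot (theta n m j / 2)) < (\<Prod>j=1..n div 2. cot (theta n m j / 2))"
proof -
  let ?g = "\<lambda>j. cot (theta n m j / 2)"
  have hm: "num_angles n m = m div 2" using assms by (simp add: num_angles_def)
  have T: "{1..n div 2} \<subseteq> {1..num_angles n m}" using num_angles_ge[of n m] assms by auto
  have B: "bottom n m \<subseteq> {1..num_angles n m}" using bottom_subset assms by simp
  have "n div 2 < num_angles n m" using assms hm by (auto elim!: evenE)
  then have ne: "bottom n m \<noteq> {1..n div 2}" using assms by (auto simp: bottom_def set_eq_iff intro!: exI[of _ "num_angles n m"])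
  have "(\<Sum>j\<in>bottom n m. ln (?g j)) < (\<Sum>j\<in>{1..n div 2}. ln (?g j))"
  proof (rule sum_less_of_separated)
    fix i j assume ij: "i \<in> bottom n m - {1..n div 2}" "j \<in> {1..n div 2} - bottom n m"
    then have "i \<in> {1..num_angles n m}" "j \<in> {1..num_angles n m}" "j < i" using T B by auto
    then show "ln (?g i) < ln (?g j)" using cot_theta_less[of j n m i] cot_theta_pos[of i n m] cot_theta_pos[of j n m] by simp
  qed (use ne num_angles_ge[of n m] assms in \<open>auto simp: bottom_def\<close>)
  moreover have nz: "?g j \<noteq> 0" if "j \<in> {1..num_angles n m}" for j using cot_theta_pos[OF that] by simp
  have "(\<Sum>j\<in>bottom n m. ln (?g j)) = ln (\<Prod>j\<in>bottom n m. ?g j)"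
    using B nz by (intro ln_prod[symmetric]) (simp add: bottom_def, blast)
  moreover have "(\<Sum>j\<in>{1..n div 2}. ln (?g j)) = ln (\<Prod>j\<in>{1..n div 2}. ?g j)"
    using T nz by (intro ln_prod[symmetric]) (simp, blast)
  moreover have "0 < (\<Prod>j\<in>bottom n m. ?g j)" "0 < (\<Prod>j\<in>{1..n div 2}. ?g j)"
    using B T by (auto intro!: prod_pos cot_theta_pos)
  ultimately show ?thesis by simp
qed

text \<open>The half angles are complementary. This is the origin of the tangents in the oscillating
  term.\<close>

lemma cot_theta_reflect:
  assumes "even n" "even m" "n \<le> m" "l \<in> {1..n div 2}"
  shows "cot (theta n m (Suc (num_angles n m) - l) / 2) = tan (theta n m l / 2)"
proof -
  have h: "2 * num_angles n m + n mod 2 = m" using assms by (simp add: num_angles_def)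
  have "0 < m" using assms by (cases m) auto
  then have "theta n m (Suc (num_angles n m) - l) = pi - (2 * real l - 1) * (pi / real m)"
    using theta_reflect(1)[OF _ _ _ h, of l] assms num_angles_ge[OF assms(3)] by auto
  also have "(2 * real l - 1) * (pi / real m) = theta n m l" using assms by (simp add: theta_def)
  finally have e: "theta n m (Suc (num_angles n m) - l) / 2 = pi / 2 - theta n m l / 2" by simp
  show ?thesis unfolding e by (simp add: cot_def tan_def sin_diff cos_diff)
qed

section \<open>Asymptotics\<close>

definition parity_sign :: "int \<Rightarrow> real" where
  "parity_sign s = (if even s then 1 else -1)"

lemma parity_sign_powi: "(-1 :: real) powi s = parity_sign s"
  by (simp add: parity_sign_def power_int_minus_left)

lemma parity_sign_add: "parity_sign (a + b) = parity_sign a * parity_sign b"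
  by (simp add: parity_sign_def)

lemma parity_sign_of_nat: "parity_sign (int k) = (-1) ^ k"
  by (simp add: parity_sign_def)

lemma prod_parity_sign: "finite A \<Longrightarrow> (\<Prod>i\<in>A. parity_sign (f i)) = parity_sign (\<Sum>i\<in>A. f i)"
  by (induction A rule: finite_induct) (auto simp: parity_sign_add parity_sign_def)

lemma cis_pi_int: "cis (pi * of_int s) = of_real (parity_sign s)" "cis (- (pi * of_int s)) = of_real (parity_sign s)"
  by (auto simp: parity_sign_def complex_eq_iff cos_int_times_real mult.commute elim!: evenE oddE)

definition sine_product :: "nat \<Rightarrow> nat \<Rightarrow> (nat \<Rightarrow> int) \<Rightarrow> real" where
  "sine_product n m x = (\<Prod>t<n. \<Prod>h<t. sin (pi * of_int (x h - x t) / real m))"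

lemma sine_product_pos:
  assumes "inside n m x"
  shows "0 < sine_product n m x"
  unfolding sine_product_def
proof (intro prod_pos ballI)
  fix t h assume "t \<in> {..<n}" "h \<in> {..<t}"
  then have d: "0 < x h - x t" "x h - x t < int m" using assms by (auto simp: inside_def)
  then have m: "0 < real m" by linarith
  have "0 < real_of_int (x h - x t)" "real_of_int (x h - x t) < real m" using d by linarith+
  then have "0 < pi * real_of_int (x h - x t)" "pi * real_of_int (x h - x t) < pi * real m"
    by (simp_all del: of_int_diff)
  then show "0 < sin (pi * real_of_int (x h - x t) / real m)"
    using m by (intro sin_gt_zero) (simp_all del: of_int_diff add: pos_divide_less_eq)
qed

text \<open>Listing the smallest angles in decreasing order, with their negatives mirrored, gives
  one decreasing arithmetic progression, through 0 if \<open>n\<close> is odd. This is the form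
  required by \<open>slater_equidistant\<close>.\<close>

lemma freq_top:
  assumes "i < n"
  shows "freq n m (\<lambda>l. n div 2 - l) i = (real n - 1 - 2 * real i) * (pi / real m)"
proof -
  have th: "theta n m (n div 2 - l) = (real n - 1 - 2 * real l) * (pi / real m)" if "l < n div 2" for l
  proof -
    have "2 * (n div 2) + n mod 2 = n" by simp
    then have "real n = 2 * real (n div 2) + real (n mod 2)" by (metis of_nat_add of_nat_mult of_nat_numeral)
    then show ?thesis using that by (simp add: theta_def of_nat_diff algebra_simps)
  qed
  have "i < n div 2 \<or> n - Suc i < n div 2 \<or> odd n \<and> i = n div 2" using assms by presburger
  then show ?thesis
  proof (elim disjE conjE)
    assume "i < n div 2" then show ?thesis by (simp add: freq_simps th)
  next
    define l where "l = n - Suc i"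
    assume "n - Suc i < n div 2"
    then have l: "l < n div 2" "i = n - Suc l" using assms by (auto simp: l_def)
    then have "real i = real n - 1 - real l" by (simp add: of_nat_diff)
    then have e: "real n - 1 - 2 * real i = - (real n - 1 - 2 * real l)" by simp
    have "freq n m (\<lambda>l. n div 2 - l) i = - ((real n - 1 - 2 * real l) * (pi / real m))"
      unfolding l(2) using l(1) by (simp only: freq_simps th)
    then show ?thesis unfolding e by (simp only: minus_mult_left)
  next
    assume i: "odd n" "i = n div 2"
    then have "real n = 2 * real i + 1" by (metis odd_two_times_div_two_succ of_nat_1 of_nat_add of_nat_mult of_nat_numeral)
    then show ?thesis using i by (simp add: freq_simps)
  qed
qed

lemma slater_top:
  "slater n (freq n m (\<lambda>l. n div 2 - l)) x = (2 * \<i>) ^ (n choose 2) * of_real (sine_product n m x)"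
proof -
  have "slater n (freq n m (\<lambda>l. n div 2 - l)) x = slater n (\<lambda>i. (real n - 1 - 2 * real i) * (pi / real m)) x"
    by (intro slater_cong freq_top)
  also have "\<dots> = (2 * \<i>) ^ (n choose 2) * of_real (sine_product n m x)"
    unfolding slater_equidistant sine_product_def prod.distrib prod_pairs_const of_real_prod power_mult_distrib
    by (simp add: mult.commute)
  finally show ?thesis .
qed

lemma even_choose_two: "even (n choose 2) \<longleftrightarrow> even (n div 2)"
proof (cases "even n")
  case True
  then obtain b where b: "n = 2 * b" by (auto elim!: evenE)
  then show ?thesis by (cases b) (auto simp: choose_two)
next
  case False
  then obtain b where b: "n = 2 * b + 1" by (auto elim!: oddE)
  have "n * (n - 1) = 2 * (b * (2 * b + 1))" unfolding b by simp
  then have "n choose 2 = b * (2 * b + 1)" by (simp add: choose_two)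
  then show ?thesis using b by simp
qed

text \<open>Reflecting the angles in pi shifts the frequencies by pi in the first half and by -pi in
  the second; at integers both give the sign (-1)^x, in total (-1)^|x|. The remaining progression is
  reversed, so every sine changes sign, altogether (-1)^(n choose 2) = (-1)^(n div 2).\<close>

lemma slater_bottom:
  assumes "even n" "even m" "n \<le> m" "0 < m"
  shows "slater n (freq n m (\<lambda>l. Suc (num_angles n m) - (n div 2 - l))) x
    = of_real (parity_sign ((\<Sum>i<n. x i) + int (n div 2))) * ((2 * \<i>) ^ (n choose 2) * of_real (sine_product n m x))"
proof -
  let ?t = "\<lambda>l. Suc (num_angles n m) - (n div 2 - l)"
  define a where "a = pi / real m"
  have h: "2 * num_angles n m + n mod 2 = m" using assms by (simp add: num_angles_def)
  have th: "theta n m (?t l) = pi - freq n m (\<lambda>l. n div 2 - l) l" if "l < n div 2" for l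
  proof -
    have "theta n m (?t l) = pi - (2 * real (n div 2 - l) - 1) * (pi / real m)"
      using theta_reflect(1)[OF _ _ _ h, of "n div 2 - l"] that num_angles_ge[OF assms(3)] assms by auto
    also have "(2 * real (n div 2 - l) - 1) * (pi / real m) = theta n m (n div 2 - l)"
      using assms by (simp add: theta_def)
    finally show ?thesis using that by (simp add: freq_simps)
  qed
  have entry: "cis (freq n m ?t i * of_int s) = of_real (parity_sign s) * cis ((real n - 1 - 2 * real i) * (- a) * of_int s)"
    if i: "i < n" for i s
  proof -
    have "freq n m ?t i = pi - freq n m (\<lambda>l. n div 2 - l) i \<or> freq n m ?t i = - pi - freq n m (\<lambda>l. n div 2 - l) i"
    proof (cases "i < n div 2")
      case True then show ?thesis using th by (simp add: freq_simps)
    next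
      case False
      define l where "l = n - Suc i"
      have l: "l < n div 2" "i = n - Suc l" using False i assms(1) by (auto simp: l_def elim!: evenE)
      show ?thesis using th[OF l(1)] l(1) unfolding l(2) by (simp add: freq_simps)
    qed
    moreover define c where "c = real n - 1 - 2 * real i"
    moreover have "(pi - c * a) * of_int s = pi * of_int s + c * (- a) * of_int s"
      "(- pi - c * a) * of_int s = - (pi * of_int s) + c * (- a) * of_int s"
      by (simp_all add: left_diff_distrib)
    ultimately have "freq n m ?t i * of_int s = pi * of_int s + (real n - 1 - 2 * real i) * (- a) * of_int s
      \<or> freq n m ?t i * of_int s = - (pi * of_int s) + (real n - 1 - 2 * real i) * (- a) * of_int s"
      unfolding freq_top[OF i] a_def[symmetric] by metis
    then show ?thesis by (elim disjE; simp only: cis_mult[symmetric] cis_pi_int)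
  qed
  have "slater n (freq n m ?t) x = of_real (parity_sign (\<Sum>i<n. x i)) * slater n (\<lambda>i. (real n - 1 - 2 * real i) * (- a)) x"
    unfolding slater_def sum_distrib_left
  proof (intro sum.cong refl)
    fix p assume "p \<in> {p. p permutes {..<n}}"
    then have p: "p permutes {..<n}" by simp
    have "(\<Prod>i<n. cis (freq n m ?t i * of_int (x (p i))))
       = of_real (\<Prod>i<n. parity_sign (x (p i))) * (\<Prod>i<n. cis ((real n - 1 - 2 * real i) * (- a) * of_int (x (p i))))"
      unfolding of_real_prod prod.distrib[symmetric] by (intro prod.cong refl entry) simp
    also have "(\<Prod>i<n. parity_sign (x (p i))) = parity_sign (\<Sum>i<n. x i)"
      using prod.permute[OF p, of "\<lambda>i. parity_sign (x i)"] by (simp add: o_def prod_parity_sign)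
    finally show "of_int (sign p) * (\<Prod>i<n. cis (freq n m ?t i * of_int (x (p i)))) =
      of_real (parity_sign (\<Sum>i<n. x i)) * (of_int (sign p) * (\<Prod>i<n. cis ((real n - 1 - 2 * real i) * (- a) * of_int (x (p i)))))"
      by (simp add: mult.left_commute)
  qed
  also have "slater n (\<lambda>i. (real n - 1 - 2 * real i) * (- a)) x = (- 2 * \<i>) ^ (n choose 2) * of_real (sine_product n m x)"
  proof -
    have "2 * \<i> * of_real (sin (- a * of_int (x h - x t))) = (- 2 * \<i>) * of_real (sin (pi * of_int (x h - x t) / real m))" for h t
      by (simp add: a_def)
    then show ?thesis
      unfolding slater_equidistant sine_product_def of_real_prod by (simp only: prod.distrib prod_pairs_const power_mult_distrib)
  qed
  also have "(- 2 * \<i>) ^ (n choose 2) = of_real ((-1) ^ (n div 2)) * (2 * \<i>) ^ (n choose 2)"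
  proof -
    have "(-1 :: complex) ^ (n choose 2) = of_real ((-1) ^ (n div 2))"
      by (simp add: minus_one_power_iff even_choose_two)
    then show ?thesis using power_mult_distrib[of "-1" "2 * \<i>" "n choose 2"] by simp
  qed
  finally show ?thesis by (simp add: parity_sign_add parity_sign_of_nat)
qed

text \<open>The bound \<open>b\<close> keeps the oscillating factor \<open>B\<close> away from 0, so
  the smaller eigenvalues are negligible relative to the main term. The sign \<open>e\<close> need
  not be known: with \<open>e = -1\<close> the count would be negative for large
  \<open>k\<close>.\<close>

lemma asymp_equiv_of_dominant:
  fixes N :: "nat \<Rightarrow> nat" and c :: "'a \<Rightarrow> complex" and lam :: "'a \<Rightarrow> real"
  assumes eq: "\<And>k. of_nat (N k) = of_real (e * (Q * L ^ k * B k)) + (\<Sum>t\<in>F. c t * of_real (lam t) ^ k)"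
    and e: "e = 1 \<or> e = - 1" and pos: "0 < Q" "0 < L" "0 < b" and B: "\<And>k. b \<le> B k"
    and F: "\<And>t. t \<in> F \<Longrightarrow> c t = 0 \<or> \<bar>lam t\<bar> < L"
  shows "(\<lambda>k. real (N k)) \<sim>[at_top] (\<lambda>k. Q * L ^ k * B k)"
proof -
  define r where "r k = Re (\<Sum>t\<in>F. c t * of_real (lam t / L) ^ k)" for k
  have "(\<lambda>k. \<Sum>t\<in>F. c t * of_real (lam t / L) ^ k) \<longlonglongrightarrow> (\<Sum>t\<in>F. 0)"
  proof (rule tendsto_sum)
    fix t assume t: "t \<in> F"
    show "(\<lambda>k. c t * of_real (lam t / L) ^ k) \<longlonglongrightarrow> 0"
    proof (cases "c t = 0")
      case False
      then have "norm (of_real (lam t / L) :: complex) < 1" using F[OF t] pos by (simp add: norm_divide)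
      then show ?thesis by (intro tendsto_mult_right_zero LIMSEQ_power_zero)
    qed simp
  qed
  then have r0: "r \<longlonglongrightarrow> 0" unfolding r_def using tendsto_Re by fastforce
  have N: "real (N k) = L ^ k * (e * Q * B k + r k)" for k
  proof -
    have "(\<Sum>t\<in>F. c t * of_real (lam t) ^ k) = of_real (L ^ k) * (\<Sum>t\<in>F. c t * of_real (lam t / L) ^ k)"
      unfolding sum_distrib_left using pos by (intro sum.cong) (auto simp: power_divide)
    then have "Re (of_nat (N k)) = Re (of_real (e * (Q * L ^ k * B k)) + of_real (L ^ k) * (\<Sum>t\<in>F. c t * of_real (lam t / L) ^ k))"
      using eq by simp
    then show ?thesis by (simp add: r_def algebra_simps)
  qed
  have "eventually (\<lambda>k. r k < Q * b) sequentially"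
    using order_tendstoD(2)[OF r0, of "Q * b"] pos by simp
  then obtain k where k: "r k < Q * b" by (auto simp: eventually_sequentially)
  have "e = 1"
  proof (rule ccontr)
    assume "e \<noteq> 1"
    then have "e = -1" using e by simp
    moreover have "Q * b \<le> Q * B k" using B pos by simp
    ultimately have "e * Q * B k + r k < 0" using k by simp
    then have "L ^ k * (e * Q * B k + r k) < 0" using pos by (simp add: mult_pos_neg)
    then show False using N[of k] by simp
  qed
  have Bpos: "0 < B k" for k using B[of k] pos by linarith
  have "(\<lambda>k. real (N k) / (Q * L ^ k * B k)) \<longlonglongrightarrow> 1"
  proof -
    have "(\<lambda>k. r k / (Q * B k)) \<longlonglongrightarrow> 0"
    proof (rule tendsto_0_le[OF r0])
      show "\<forall>\<^sub>F k in sequentially. norm (r k / (Q * B k)) \<le> norm (r k) * (1 / (Q * b))"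
      proof (intro always_eventually allI)
        fix k
        have "Q * b \<le> Q * B k" using B pos by simp
        then show "norm (r k / (Q * B k)) \<le> norm (r k) * (1 / (Q * b))"
          using pos Bpos[of k] by (simp add: abs_mult frac_le)
      qed
    qed
    then have "(\<lambda>k. 1 + r k / (Q * B k)) \<longlonglongrightarrow> 1" using tendsto_add[OF tendsto_const[of 1]] by fastforce
    moreover have "real (N k) / (Q * L ^ k * B k) = 1 + r k / (Q * B k)" for k
      using pos Bpos[of k] unfolding N \<open>e = 1\<close> by (simp add: field_simps)
    ultimately show ?thesis by simp
  qed
  then show ?thesis by (rule asymp_equivI')
qed

lemma inside_dimension:
  assumes "inside n m x" "1 \<le> n" "1 \<le> m"
  shows "n \<le> m"
proof -
  have "int d \<le> x 0 - x d" if "d < n" for d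
    using that
  proof (induction d)
    case (Suc d)
    then have "x (Suc d) < x d" using assms(1) by (auto simp: inside_def)
    then show ?case using Suc by simp
  qed simp
  from this[of "n - 1"] have "int (n - 1) \<le> x 0 - x (n - 1)" using assms by simp
  moreover have "n \<noteq> 1 \<Longrightarrow> x 0 - x (n - 1) < int m" using assms by (auto simp: inside_def)
  ultimately show ?thesis using assms by (cases "n = 1") auto
qed

text \<open>The exponents \<open>n div 2\<close> and \<open>n choose 2\<close> have the same parity,
  so the powers of i combine to a real unit.\<close>

lemma phase_sign: "(- \<i>) ^ (n div 2) * \<i> ^ (n choose 2) \<in> {1, -1}"
proof -
  have "even (n div 2 + (n choose 2))" by (simp add: even_choose_two)
  then obtain q where q: "n div 2 + (n choose 2) = 2 * q" by (elim evenE)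
  have "(- \<i>) ^ (n div 2) * \<i> ^ (n choose 2) = (-1) ^ (n div 2) * \<i> ^ (n div 2 + (n choose 2))"
    by (simp add: power_add power_minus[of \<i>])
  also have "\<dots> = (-1) ^ (n div 2) * (-1) ^ q" unfolding q power_mult by simp
  finally show ?thesis by (auto simp: minus_one_power_iff)
qed

text \<open>Relative contribution of the eigenvalue \<open>- top_eigenvalue n m\<close>: the
  coordinate sum and \<open>n div 2\<close> in the sign come from the reflected Slater determinant,
  \<open>k\<close> from the power of the negative eigenvalue.\<close>

definition second_term :: "nat \<Rightarrow> nat \<Rightarrow> (nat \<Rightarrow> int) \<Rightarrow> nat \<Rightarrow> real" where
  "second_term n m x k = (if even n \<and> even m
     then parity_sign ((\<Sum>i<n. x i) + int k + int (n div 2)) * (\<Prod>j\<in>bottom n m. cot (theta n m j / 2)) else 0)"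

lemma sum_tuples_onto_top:
  assumes "n \<le> m"
  shows "(\<Sum>t\<in>tuples_onto n m {1..n div 2}. amplitude n m t * slater n (freq n m t) x * of_real (eigenvalue n m t) ^ k)
    = ((- \<i>) ^ (n div 2) * \<i> ^ (n choose 2))
      * of_real (fact (n div 2) * (2 / real m) ^ (n div 2) * 2 ^ (n choose 2) * sine_product n m x
          * top_eigenvalue n m ^ k * (\<Prod>j=1..n div 2. cot (theta n m j / 2)))"
proof -
  have inj: "inj_on (\<lambda>l. n div 2 - l) {..<n div 2}" by (auto simp: inj_on_def)
  have img: "(\<lambda>l. n div 2 - l) ` {..<n div 2} = {1..n div 2}"
  proof (intro equalityI subsetI)
    fix j assume "j \<in> {1..n div 2}"
    then have "n div 2 - j < n div 2" "j = n div 2 - (n div 2 - j)" by auto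
    then show "j \<in> (\<lambda>l. n div 2 - l) ` {..<n div 2}" by blast
  qed auto
  have sub: "{1..n div 2} \<subseteq> {1..num_angles n m}" using num_angles_ge[OF assms] by auto
  show ?thesis
    unfolding sum_tuples_onto[OF sub inj img] slater_top top_eigenvalue_def[symmetric]
    by (simp add: power_mult_distrib)
qed

lemma sum_tuples_onto_bottom:
  assumes "even n" "even m" "n \<le> m" "0 < m"
  shows "(\<Sum>t\<in>tuples_onto n m (bottom n m). amplitude n m t * slater n (freq n m t) x * of_real (eigenvalue n m t) ^ k)
    = ((- \<i>) ^ (n div 2) * \<i> ^ (n choose 2))
      * of_real (fact (n div 2) * (2 / real m) ^ (n div 2) * 2 ^ (n choose 2) * sine_product n m x
          * top_eigenvalue n m ^ k * second_term n m x k)"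
proof -
  let ?s = "\<lambda>l. Suc (num_angles n m) - (n div 2 - l)"
  have inj: "inj_on ?s {..<n div 2}" using num_angles_ge[OF assms(3)] by (auto simp: inj_on_def)
  have img: "?s ` {..<n div 2} = bottom n m"
  proof (intro equalityI subsetI)
    fix j assume "j \<in> bottom n m"
    then have "n div 2 - (Suc (num_angles n m) - j) < n div 2" "j = ?s (n div 2 - (Suc (num_angles n m) - j))"
      using num_angles_ge[OF assms(3)] by (auto simp: bottom_def)
    then show "j \<in> ?s ` {..<n div 2}" by blast
  qed (use num_angles_ge[OF assms(3)] in \<open>auto simp: bottom_def\<close>)
  have eig: "real (n mod 2) + (\<Sum>j\<in>bottom n m. 2 * cos (theta n m j)) = - top_eigenvalue n m"
    using bottom_eigenvalue_even[OF assms] by (simp add: bottom_eigenvalue_def)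
  have sgn: "parity_sign ((\<Sum>i<n. x i) + int k + int (n div 2)) = parity_sign ((\<Sum>i<n. x i) + int (n div 2)) * (-1) ^ k"
    by (simp add: parity_sign_add parity_sign_of_nat)
  show ?thesis
    unfolding sum_tuples_onto[OF bottom_subset[OF assms(3)] inj img] slater_bottom[OF assms] eig
    using assms sgn by (simp add: second_term_def power_mult_distrib power_minus[of "complex_of_real _"])
qed

lemma walk_count_asymptotics:
  fixes x :: "int vec"
  assumes "1 \<le> n" "n < m" and x: "map_vec real_of_int x \<in> alcove n m"
  shows "(\<lambda>k. real (card (walks_from (standard_steps n) (alcove n m) (map_vec real_of_int x) k)))
    \<sim>[at_top] (\<lambda>k. (2 ^ (n choose 2) / real m ^ (n div 2) * sine_product n m (\<lambda>i. x $ i)) * top_eigenvalue n m ^ k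
      * ((\<Prod>j=1..n div 2. cot (theta n m j / 2)) + second_term n m (\<lambda>i. x $ i) k))"
proof -
  let ?x = "\<lambda>i. x $ i"
  define h where "h = n div 2"
  define N where "N k = card (walks_from (standard_steps n) (alcove n m) (map_vec real_of_int x) k)" for k
  define K where "K = nested n (\<lambda>l. sg)"
  define \<phi> where "\<phi> = (- \<i>) ^ h * \<i> ^ (n choose 2)"
  define a where "a t = amplitude n m t * slater n (freq n m t) ?x" for t
  define A where "A = (\<Prod>j=1..h. cot (theta n m j / 2))"
  define C where "C = (\<Prod>j\<in>bottom n m. cot (theta n m j / 2))"
  define L where "L = top_eigenvalue n m"
  define Q where "Q = 2 ^ (n choose 2) / real m ^ h * sine_product n m ?x"
  define B where "B k = A + second_term n m ?x k" for k
  \<comment> \<open>The tuples whose eigenvalue has the maximal modulus \<open>L\<close>.\<close>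
  define D where "D = tuples_onto n m {1..h} \<union> (if even n \<and> even m then tuples_onto n m (bottom n m) else {})"
  define F where "F = tuples n m - D"
  have nm: "n \<le> m" "1 \<le> m" "0 < m" using assms by auto
  have hh: "h \<le> num_angles n m" using num_angles_ge[OF nm(1)] by (simp add: h_def)
  have "x \<in> carrier_vec n" using x by (auto simp: alcove_def)
  then have ins: "inside n m ?x" using alcove_iff_inside assms(1) nm(2) x by blast
  have fin: "finite (tuples n m)" by (intro finite_PiE) auto
  have DT: "D \<subseteq> tuples n m" by (auto simp: D_def tuples_onto_def)
  have Apos: "0 < A" unfolding A_def using hh by (intro prod_pos) (auto intro!: cot_theta_pos)
  have CA: "C < A" if "even n" "even m"
  proof -
    have "2 \<le> n" using that assms(1) by presburger
    then show ?thesis using prod_cot_bottom_less that assms by (simp add: A_def C_def h_def)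
  qed
  \<comment> \<open>Equal sets would give equal products, so the strict inequality also shows that
    the two dominant families are disjoint.\<close>
  have ne: "bottom n m \<noteq> {1..h}" if "even n" "even m"
    using CA[OF that] by (auto simp: A_def C_def)
  have "K * of_nat (N k) = \<phi> * of_real (fact h * (2 / real m) ^ h * 2 ^ (n choose 2) * sine_product n m ?x * L ^ k * B k)
      + (\<Sum>t\<in>F. a t * of_real (eigenvalue n m t) ^ k)" for k
  proof -
    have "K * of_nat (N k) = (\<Sum>t\<in>tuples n m. a t * of_real (eigenvalue n m t) ^ k)"
      unfolding K_def N_def a_def by (rule walk_count_expansion[OF assms(1) nm(2) x])
    also have "\<dots> = (\<Sum>t\<in>F. a t * of_real (eigenvalue n m t) ^ k) + (\<Sum>t\<in>D. a t * of_real (eigenvalue n m t) ^ k)"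
      unfolding F_def by (rule sum.subset_diff[OF DT fin])
    also have "(\<Sum>t\<in>D. a t * of_real (eigenvalue n m t) ^ k)
      = \<phi> * of_real (fact h * (2 / real m) ^ h * 2 ^ (n choose 2) * sine_product n m ?x * L ^ k * B k)"
    proof -
      define c where "c = fact h * (2 / real m) ^ h * 2 ^ (n choose 2) * sine_product n m ?x * L ^ k"
      have top: "(\<Sum>t\<in>tuples_onto n m {1..h}. a t * of_real (eigenvalue n m t) ^ k) = \<phi> * of_real (c * A)"
        unfolding a_def h_def \<phi>_def L_def A_def c_def by (rule sum_tuples_onto_top[OF nm(1)])
      show ?thesis
      proof (cases "even n \<and> even m")
        case True
        have bot: "(\<Sum>t\<in>tuples_onto n m (bottom n m). a t * of_real (eigenvalue n m t) ^ k) = \<phi> * of_real (c * second_term n m ?x k)"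
          unfolding a_def h_def \<phi>_def L_def c_def using True by (intro sum_tuples_onto_bottom nm) auto
        have "(\<Sum>t\<in>D. a t * of_real (eigenvalue n m t) ^ k)
          = (\<Sum>t\<in>tuples_onto n m {1..h}. a t * of_real (eigenvalue n m t) ^ k)
            + (\<Sum>t\<in>tuples_onto n m (bottom n m). a t * of_real (eigenvalue n m t) ^ k)"
          unfolding D_def if_P[OF True]
          by (rule sum.union_disjoint) (use fin ne True in \<open>auto simp: tuples_onto_def intro: finite_subset\<close>)
        then show ?thesis unfolding top bot B_def c_def[symmetric] by (simp only: distrib_left of_real_add)
      next
        case False
        then have "D = tuples_onto n m {1..h}" "B k = A" by (auto simp: D_def B_def second_term_def)
        then show ?thesis unfolding c_def[symmetric] using top by simp
      qed
    qed
    finally show ?thesis by simp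
  qed
  note expansion = this
  \<comment> \<open>The undetermined signs of \<open>\<phi>\<close> and \<open>K\<close> merge into
    a single one.\<close>
  obtain e where e: "e = 1 \<or> e = (-1 :: real)" and K: "\<phi> = of_real e * K / of_real (2 ^ h * fact h)" "K \<noteq> 0"
  proof -
    have K: "K = 2 ^ h * fact h \<or> K = - (2 ^ h * fact h)" using nested_sign[of n] by (auto simp: K_def h_def)
    have "\<phi> = 1 \<or> \<phi> = -1" using phase_sign[of n] by (auto simp: \<phi>_def h_def)
    then show ?thesis using K that[of 1] that[of "-1"] by (elim disjE) auto
  qed
  have "(\<lambda>k. real (N k)) \<sim>[at_top] (\<lambda>k. Q * L ^ k * B k)"
  proof (rule asymp_equiv_of_dominant)
    show "e = 1 \<or> e = -1" by (rule e)
    show "0 < Q" using sine_product_pos[OF ins] nm by (simp add: Q_def)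
    show "0 < L" using top_eigenvalue_pos[OF assms(1,2)] by (simp add: L_def)
    \<comment> \<open>If both are even, \<open>A - C\<close> is the value of \<open>B\<close> when
      the oscillating sign is -1.\<close>
    show "0 < (if even n \<and> even m then A - C else A)" using CA Apos by simp
    have Cpos: "0 < C" unfolding C_def using bottom_subset[OF nm(1)] by (intro prod_pos) (auto intro!: cot_theta_pos)
    show "(if even n \<and> even m then A - C else A) \<le> B k" for k
      using Cpos by (auto simp: B_def second_term_def C_def[symmetric] parity_sign_def)
    show "of_nat (N k) = of_real (e * (Q * L ^ k * B k)) + (\<Sum>t\<in>F. (a t / K) * of_real (eigenvalue n m t) ^ k)" for k
    proof -
      have "of_nat (N k) = (\<phi> / K) * of_real (fact h * (2 / real m) ^ h * 2 ^ (n choose 2) * sine_product n m ?x * L ^ k * B k)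
          + (\<Sum>t\<in>F. a t * of_real (eigenvalue n m t) ^ k) / K"
        using expansion[of k] K(2) by (simp add: field_simps)
      also have "\<phi> / K = of_real (e / (2 ^ h * fact h))" using K by simp
      \<comment> \<open>Here \<open>2 ^ h * fact h\<close> cancels, and of
        \<open>(2 / real m) ^ h\<close> only the power of \<open>m\<close> survives.\<close>
      also have "of_real (e / (2 ^ h * fact h)) * of_real (fact h * (2 / real m) ^ h * 2 ^ (n choose 2) * sine_product n m ?x * L ^ k * B k)
          = (of_real (e * (Q * L ^ k * B k)) :: complex)"
        unfolding of_real_mult[symmetric] Q_def using nm by (simp add: power_divide)
      finally show ?thesis by (simp add: sum_divide_distrib)
    qed
    fix t assume t: "t \<in> F"
    then have tt: "t \<in> tuples n m" and tD: "t \<notin> D" by (auto simp: F_def)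
    show "a t / K = 0 \<or> \<bar>eigenvalue n m t\<bar> < L"
    proof (cases "inj_on t {..<n div 2}")
      case False
      then show ?thesis using slater_not_inj by (simp add: a_def)
    next
      case True
      then have top: "t ` {..<n div 2} \<noteq> {1..n div 2}" using tt tD by (auto simp: D_def tuples_onto_def h_def)
      have "- L < eigenvalue n m t"
      proof (cases "even n \<and> even m")
        case ev: True
        then have "t ` {..<n div 2} \<noteq> bottom n m" using tt tD True by (auto simp: D_def tuples_onto_def)
        then show ?thesis
          using eigenvalue_greater_bottom[OF nm(1) tt True] bottom_eigenvalue_even[of n m] ev nm by (simp add: L_def)
      next
        case False
        have "bottom_eigenvalue n m \<le> eigenvalue n m t"
        proof (cases "t ` {..<n div 2} = bottom n m")
          case im: True
          show ?thesis unfolding eigenvalue_image[OF True] im bottom_eigenvalue_def by simp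
        next
          case False then show ?thesis using eigenvalue_greater_bottom[OF nm(1) tt True] by simp
        qed
        then show ?thesis using bottom_eigenvalue_greater[OF assms(1,2) False] by (simp add: L_def)
      qed
      then show ?thesis using eigenvalue_less_top[OF nm(1) tt True top] by (simp add: L_def abs_less_iff)
    qed
  qed
  then show ?thesis unfolding N_def Q_def L_def B_def A_def h_def .
qed

text \<open>For \<open>m = n\<close> there are only \<open>n div 2\<close> angles, so every nonzero
  determinant belongs to the top eigenvalue. For n > 1 this is sin(pi)/sin(pi/n) = 0, and
  \<open>Suc k\<close> avoids 0^0. For n = 1 the only tuple is empty and has eigenvalue 1.\<close>

lemma walk_count_degenerate:
  fixes x :: "int vec"
  assumes "1 \<le> n" "m = n" and x: "map_vec real_of_int x \<in> alcove n m"
  shows "card (walks_from (standard_steps n) (alcove n m) (map_vec real_of_int x) (Suc k)) = (if n = 1 then 1 else 0)"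
proof -
  let ?N = "card (walks_from (standard_steps n) (alcove n m) (map_vec real_of_int x) (Suc k))"
  define K where "K = nested n (\<lambda>l. sg)"
  have m: "1 \<le> m" using assms by simp
  have K: "K = 2 ^ (n div 2) * fact (n div 2) \<or> K = - (2 ^ (n div 2) * fact (n div 2))"
    using nested_sign[of n] by (auto simp: K_def)
  have expansion: "K * of_nat ?N = (\<Sum>t\<in>tuples n m. amplitude n m t * slater n (freq n m t) (\<lambda>i. x $ i) * of_real (eigenvalue n m t) ^ Suc k)"
    unfolding K_def by (rule walk_count_expansion[OF assms(1) m x])
  show ?thesis
  proof (cases "n = 1")
    case True
    have "slater 1 q (\<lambda>i. x $ i) = cis (q 0 * of_int (x $ 0))" for q
      by (simp add: slater_det det_single)
    then have "K * of_nat ?N = 1"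
      unfolding expansion using True by (simp add: amplitude_def eigenvalue_def freq_def)
    moreover have "K = 1 \<or> K = -1" using K True by simp
    ultimately have "of_nat ?N = (1 :: complex) \<or> of_nat ?N = (-1 :: complex)"
      by (metis minus_minus mult_1 mult_minus1)
    then have "real ?N = 1 \<or> real ?N = -1" by (auto dest: arg_cong[of _ _ Re])
    then show ?thesis using True by simp
  next
    case False
    have "amplitude n m t * slater n (freq n m t) (\<lambda>i. x $ i) * of_real (eigenvalue n m t) ^ Suc k = 0"
      if t: "t \<in> tuples n m" for t
    proof (cases "inj_on t {..<n div 2}")
      case True
      have "num_angles n m = n div 2" using assms(2) unfolding num_angles_def by presburger
      then have "t ` {..<n div 2} \<subseteq> {1..n div 2}" "card (t ` {..<n div 2}) = n div 2"
        using t True by (auto simp: card_image)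
      then have "t ` {..<n div 2} = {1..n div 2}" by (intro card_subset_eq) auto
      then have "eigenvalue n m t = top_eigenvalue n m" unfolding eigenvalue_image[OF True] top_eigenvalue_def by simp
      also have "\<dots> = 0"
      proof -
        have "0 < sin (pi / real m)" using False assms by (intro sin_gt_zero) (auto simp: field_simps)
        then show ?thesis using sin_top_eigenvalue[of m n] assms(1,2) by simp
      qed
      finally show ?thesis by simp
    qed (simp add: slater_not_inj)
    then have "K * of_nat ?N = 0" unfolding expansion by (intro sum.neutral) blast
    then show ?thesis using K False by auto
  qed
qed

theorem theorem13:
  fixes n m :: nat and \<eta> :: "int vec"
  assumes "n \<ge> 1" and "m \<ge> 1"
    and "map_vec real_of_int \<eta> \<in> alcove n m"
  shows
    "(even n \<and> even m \<longrightarrow>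
      (\<lambda>k. real (card (walks_from (standard_steps n) (alcove n m) (map_vec real_of_int \<eta>) k)))
      \<sim>[at_top]
      (\<lambda>k. 2 ^ (n choose 2) / real m ^ (n div 2) * sine_quotient n m ^ k
         * (\<Prod>t<n. \<Prod>h<t. sin (pi * real_of_int (\<eta> $ h - \<eta> $ t) / real m))
         * ((\<Prod>h=1..n div 2. cot (real (2 * h - 1) * pi / (2 * real m)))
            + (-1) powi ((\<Sum>i<n. \<eta> $ i) + int k + int (n div 2))
              * (\<Prod>h=1..n div 2. tan (real (2 * h - 1) * pi / (2 * real m)))))) \<and>
    (even n \<and> odd m \<longrightarrow>
      (\<lambda>k. real (card (walks_from (standard_steps n) (alcove n m) (map_vec real_of_int \<eta>) k)))
      \<sim>[at_top]
      (\<lambda>k. 2 ^ (n choose 2) / real m ^ (n div 2) * sine_quotient n m ^ k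
         * (\<Prod>t<n. \<Prod>h<t. sin (pi * real_of_int (\<eta> $ h - \<eta> $ t) / real m))
         * (\<Prod>h=1..n div 2. cot (real (2 * h - 1) * pi / (2 * real m))))) \<and>
    (odd n \<longrightarrow>
      (\<lambda>k. real (card (walks_from (standard_steps n) (alcove n m) (map_vec real_of_int \<eta>) k)))
      \<sim>[at_top]
      (\<lambda>k. 2 ^ (n choose 2) / real m ^ ((n - 1) div 2) * sine_quotient n m ^ k
         * (\<Prod>t<n. \<Prod>h<t. sin (pi * real_of_int (\<eta> $ h - \<eta> $ t) / real m))
         * (\<Prod>h=1..(n - 1) div 2. cot (real h * pi / real m))))"
proof -
  have "\<eta> \<in> carrier_vec n" using assms(3) by (auto simp: alcove_def)
  then have "inside n m (\<lambda>i. \<eta> $ i)" using alcove_iff_inside assms by blast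
  then have "n \<le> m" using inside_dimension assms by blast
  \<comment> \<open>The boundary case \<open>m = n\<close> splits because the sine quotient is 0 for
    n > 1 but is read as 1 for m = 1.\<close>
  then consider "n < m" | "m = n" "n \<noteq> 1" | "m = 1" "n = 1" by linarith
  then show ?thesis
  proof cases
    case 1
    have "0 < sin (pi / real m)" using 1 assms by (intro sin_gt_zero) (auto simp: field_simps)
    then have L: "top_eigenvalue n m = sine_quotient n m"
      using sin_top_eigenvalue[of m n] 1 assms by (simp add: sine_quotient_def field_simps)
    have even_theta: "theta n m h / 2 = real (2 * h - 1) * pi / (2 * real m)" if "even n" "h \<in> {1..n div 2}" for h
      using that by (simp add: theta_def of_nat_diff)
    have odd_theta: "theta n m h / 2 = real h * pi / real m" if "odd n" for h
      using that by (simp add: theta_def odd_iff_mod_2_eq_one)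
    have cot_even: "(\<Prod>j=1..n div 2. cot (theta n m j / 2)) = (\<Prod>h=1..n div 2. cot (real (2 * h - 1) * pi / (2 * real m)))"
      if "even n" using even_theta[OF that] by (intro prod.cong refl) (simp only:)
    have cot_odd: "(\<Prod>j=1..n div 2. cot (theta n m j / 2)) = (\<Prod>h=1..n div 2. cot (real h * pi / real m))"
      if "odd n" using odd_theta[OF that] by (intro prod.cong refl) (simp only:)
    have tan_even: "(\<Prod>j\<in>bottom n m. cot (theta n m j / 2)) = (\<Prod>h=1..n div 2. tan (real (2 * h - 1) * pi / (2 * real m)))"
      if ev: "even n" "even m"
    proof -
      have "(\<Prod>j\<in>bottom n m. cot (theta n m j / 2)) = (\<Prod>h=1..n div 2. tan (theta n m h / 2))"
        unfolding prod_bottom[OF \<open>n \<le> m\<close>]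
        by (intro prod.cong refl cot_theta_reflect ev \<open>n \<le> m\<close>)
      also have "\<dots> = (\<Prod>h=1..n div 2. tan (real (2 * h - 1) * pi / (2 * real m)))"
        using even_theta[OF ev(1)] by (intro prod.cong refl) (simp only:)
      finally show ?thesis .
    qed
    note asymp = walk_count_asymptotics[OF assms(1) 1 assms(3), unfolded L sine_product_def]
    show ?thesis
    proof (intro conjI impI)
      assume ev: "even n \<and> even m"
      then show "(\<lambda>k. real (card (walks_from (standard_steps n) (alcove n m) (map_vec real_of_int \<eta>) k)))
        \<sim>[at_top]
        (\<lambda>k. 2 ^ (n choose 2) / real m ^ (n div 2) * sine_quotient n m ^ k
         * (\<Prod>t<n. \<Prod>h<t. sin (pi * real_of_int (\<eta> $ h - \<eta> $ t) / real m))
         * ((\<Prod>h=1..n div 2. cot (real (2 * h - 1) * pi / (2 * real m)))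
            + (-1) powi ((\<Sum>i<n. \<eta> $ i) + int k + int (n div 2))
              * (\<Prod>h=1..n div 2. tan (real (2 * h - 1) * pi / (2 * real m)))))"
        using asymp unfolding second_term_def if_P[OF ev] parity_sign_powi cot_even[OF conjunct1[OF ev]]
          tan_even[OF conjunct1[OF ev] conjunct2[OF ev]] by (simp only: mult_ac)
    next
      assume ev: "even n \<and> odd m"
      then show "(\<lambda>k. real (card (walks_from (standard_steps n) (alcove n m) (map_vec real_of_int \<eta>) k)))
        \<sim>[at_top]
        (\<lambda>k. 2 ^ (n choose 2) / real m ^ (n div 2) * sine_quotient n m ^ k
         * (\<Prod>t<n. \<Prod>h<t. sin (pi * real_of_int (\<eta> $ h - \<eta> $ t) / real m))
         * (\<Prod>h=1..n div 2. cot (real (2 * h - 1) * pi / (2 * real m))))"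
        using asymp cot_even by (simp add: second_term_def mult_ac)
    next
      assume od: "odd n"
      then have "(n - 1) div 2 = n div 2" by (auto elim!: oddE)
      then show "(\<lambda>k. real (card (walks_from (standard_steps n) (alcove n m) (map_vec real_of_int \<eta>) k)))
        \<sim>[at_top]
        (\<lambda>k. 2 ^ (n choose 2) / real m ^ ((n - 1) div 2) * sine_quotient n m ^ k
         * (\<Prod>t<n. \<Prod>h<t. sin (pi * real_of_int (\<eta> $ h - \<eta> $ t) / real m))
         * (\<Prod>h=1..(n - 1) div 2. cot (real h * pi / real m)))"
        using asymp cot_odd od by (simp add: second_term_def mult_ac)
    qed
  next
    case 2
    let ?N = "\<lambda>k. real (card (walks_from (standard_steps n) (alcove n m) (map_vec real_of_int \<eta>) k))"
    have "sine_quotient n m = 0" using 2 assms by (simp add: sine_quotient_def)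
    \<comment> \<open>At \<open>k = 0\<close> the power is 1; asymptotic equivalence only concerns
      large \<open>k\<close>, where both sides are 0.\<close>
    then have z: "\<forall>k\<ge>1. sine_quotient n m ^ k = 0" by simp
    have "\<forall>k\<ge>1. ?N k = 0"
      using walk_count_degenerate[OF assms(1) 2(1) assms(3)] 2(2) by (metis One_nat_def Suc_le_D of_nat_0)
    then have "eventually (\<lambda>k. ?N k = a * sine_quotient n m ^ k * b * c k) at_top" for a b c
      using z by (intro eventually_at_top_linorderI[of 1]) auto
    then show ?thesis by (intro conjI impI asymp_equiv_refl_ev)
  next
    case 3
    let ?N = "\<lambda>k. real (card (walks_from (standard_steps n) (alcove n m) (map_vec real_of_int \<eta>) k))"
    have "\<forall>k\<ge>1. ?N k = 1"
      using walk_count_degenerate[OF assms(1) _ assms(3)] 3 by (metis One_nat_def Suc_le_D of_nat_1)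
    then have "eventually (\<lambda>k. ?N k = 1) at_top" by (intro eventually_at_top_linorderI[of 1]) auto
    moreover have "Suc 0 choose 2 = 0" by (simp add: binomial_eq_0)
    ultimately show ?thesis using 3 by (auto simp: sine_quotient_def binomial_eq_0 intro!: asymp_equiv_refl_ev)
  qed
qed

end
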